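(* Let $n\geq 4$ and let $B\subset\mathbb{R}^{n+1}$ be a symmetric convex body. Suppose that there is a fixed body of revolution $K\subset\mathbb{R}^n$ such that every orthogonal projection of $B$ onto a hyperplane of $\mathbb{R}^{n+1}$ is linearly equivalent to $K$. Then $B$ is an ellipsoid.
   Context: A symmetric convex body is a compact convex subset with nonempty interior of a finite-dimensional real vector space, invariant under $x\mapsto -x$. A hyperplane is a codimension-one linear subspace; an affine hyperplane is a translate of a hyperplane. Two sets, each a subset of a vector space, are linearly (respectively affinely) equivalent if they can be mapped to each other by a linear (respectively affine) isomorphism between their ambient vector spaces; for a projection onto a hyperplane, the ambient space is that hyperplane. An ellipsoid is a subset of a vector space affinely equivalent to the unit ball of a Euclidean space. A convex body $K\subset\mathbb{R}^n$ is a body of revolution if it admits an axis of revolution, i.e. a line $L$ such that each section of $K$ by an affine hyperplane $\Delta$ orthogonal to $L$ is an $(n-1)$-dimensional Euclidean ball in $\Delta$ centered at $\Delta\cap L$ (possibly empty or just a point). *)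

theory Defs
  imports "HOL-Analysis.Analysis"
begin

definition convex_body :: "'a::euclidean_space set \<Rightarrow> bool" where
  "convex_body K \<longleftrightarrow> compact K \<and> convex K \<and> interior K \<noteq> {}"

definition symmetric_convex_body :: "'a::euclidean_space set \<Rightarrow> bool" where
  "symmetric_convex_body B \<longleftrightarrow> convex_body B \<and> uminus ` B = B"

definition hyperplane :: "'a::euclidean_space set \<Rightarrow> bool" where
  "hyperplane H \<longleftrightarrow> subspace H \<and> dim H + 1 = DIM('a)"

definition affine_hyperplane :: "'a::euclidean_space set \<Rightarrow> bool" where
  "affine_hyperplane D \<longleftrightarrow> (\<exists>H a. hyperplane H \<and> D = (+) a ` H)"

text \<open>Lines are affine; they need not pass through the origin.\<close>

definition line :: "'a::euclidean_space set \<Rightarrow> bool" where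
  "line L \<longleftrightarrow> affine L \<and> aff_dim L = 1"

definition affine_orthogonal :: "'a::euclidean_space set \<Rightarrow> 'a set \<Rightarrow> bool" where
  "affine_orthogonal D L \<longleftrightarrow>
     (\<forall>u\<in>D. \<forall>v\<in>D. \<forall>x\<in>L. \<forall>y\<in>L. orthogonal (u - v) (x - y))"

text \<open>A section may be empty or a single point: these are the cases
  \<open>r < 0\<close> and \<open>r = 0\<close> below.\<close>

definition axis_of_revolution :: "'a::euclidean_space set \<Rightarrow> 'a set \<Rightarrow> bool" where
  "axis_of_revolution K L \<longleftrightarrow> line L \<and>
     (\<forall>D. affine_hyperplane D \<and> affine_orthogonal D L \<longrightarrow>
        (\<exists>p r. D \<inter> L = {p} \<and> K \<inter> D = cball p r \<inter> D))"

definition body_of_revolution :: "'a::euclidean_space set \<Rightarrow> bool" where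
  "body_of_revolution K \<longleftrightarrow> convex_body K \<and> (\<exists>L. axis_of_revolution K L)"

definition orthogonal_projection :: "'a::euclidean_space set \<Rightarrow> 'a \<Rightarrow> 'a" where
  "orthogonal_projection H x = (THE y. y \<in> H \<and> x - y \<in> H\<^sup>\<bottom>)"

lemma orthogonal_projection_eq_iff:
  fixes H :: "'a::euclidean_space set"
  assumes "subspace H"
  shows "orthogonal_projection H x = y \<longleftrightarrow> y \<in> H \<and> x - y \<in> H\<^sup>\<bottom>"
proof -
  have uniq: "y = z" if "y \<in> H" "x - y \<in> H\<^sup>\<bottom>" "z \<in> H" "x - z \<in> H\<^sup>\<bottom>" for y z
  proof -
    have "(x - z) - (x - y) \<in> H\<^sup>\<bottom>"
      using that subspace_diff [OF subspace_orthogonal_comp] by blast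
    hence "y - z \<in> H\<^sup>\<bottom>" by simp
    moreover have "y - z \<in> H"
      using assms that by (simp add: subspace_diff)
    ultimately have "orthogonal (y - z) (y - z)"
      unfolding orthogonal_comp_def by blast
    thus ?thesis by (simp add: orthogonal_self)
  qed
  obtain u v where uv: "u \<in> span H" "\<And>w. w \<in> span H \<Longrightarrow> orthogonal v w" "x = u + v"
    using orthogonal_subspace_decomp_exists [of H x] by metis
  have u: "u \<in> H \<and> x - u \<in> H\<^sup>\<bottom>"
    using uv span_eq_iff [THEN iffD2, OF assms]
    by (auto simp: orthogonal_comp_def orthogonal_commute)
  have "orthogonal_projection H x = u"
    unfolding orthogonal_projection_def using u uniq by (intro the_equality) blast+
  thus ?thesis using u uniq by metis
qed

text \<open>The ambient spaces \<open>V\<close> and \<open>W\<close> are linear subspaces of Euclidean spaces. A linear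
  map \<open>V \<rightarrow> W\<close> is represented by a linear extension of it to the whole type, which always
  exists; so \<open>linear_isomorphism f V W\<close> constrains only the restriction of \<open>f\<close> to \<open>V\<close>.\<close>

definition linear_isomorphism ::
  "('a::euclidean_space \<Rightarrow> 'b::euclidean_space) \<Rightarrow> 'a set \<Rightarrow> 'b set \<Rightarrow> bool" where
  "linear_isomorphism f V W \<longleftrightarrow> linear f \<and> bij_betw f V W"

text \<open>\<open>linearly_equivalent V S W T\<close>: the set \<open>S\<close> with ambient space \<open>V\<close> is equivalent to the
  set \<open>T\<close> with ambient space \<open>W\<close>; similarly for \<open>affinely_equivalent\<close>.\<close>

definition linearly_equivalent ::
  "'a::euclidean_space set \<Rightarrow> 'a set \<Rightarrow> 'b::euclidean_space set \<Rightarrow> 'b set \<Rightarrow> bool" where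
  "linearly_equivalent V S W T \<longleftrightarrow> subspace V \<and> subspace W \<and> S \<subseteq> V \<and> T \<subseteq> W \<and>
     (\<exists>f. linear_isomorphism f V W \<and> f ` S = T)"

definition affinely_equivalent ::
  "'a::euclidean_space set \<Rightarrow> 'a set \<Rightarrow> 'b::euclidean_space set \<Rightarrow> 'b set \<Rightarrow> bool" where
  "affinely_equivalent V S W T \<longleftrightarrow> subspace V \<and> subspace W \<and> S \<subseteq> V \<and> T \<subseteq> W \<and>
     (\<exists>f. \<exists>c\<in>W. linear_isomorphism f V W \<and> (\<lambda>x. f x + c) ` S = T)"

text \<open>An affine isomorphism preserves dimension and Euclidean spaces of equal dimension are
  isometric, so the type itself can serve as the Euclidean space whose unit ball is used.\<close>

definition ellipsoid :: "'a::euclidean_space set \<Rightarrow> bool" where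
  "ellipsoid E \<longleftrightarrow> affinely_equivalent (UNIV :: 'a set) E (UNIV :: 'a set) (cball 0 1)"

end

theory Submission
  imports Defs
begin

text \<open>Let \<open>F\<close> be the support function of \<open>B\<close>. The restriction of \<open>F\<close> to a hyperplane \<open>x\<^sup>\<bottom>\<close> is
  the support function of the projection, hence linearly isometric to the fixed rotational norm
  \<open>support_function K\<close>: there are a vector \<open>e\<^sub>x\<close> and an inner product on \<open>x\<^sup>\<bottom>\<close> such that \<open>F y\<close> depends
  only on \<open>e\<^sub>x \<bullet> y\<close> and on the length of \<open>y\<close>. Suppose that no restriction is Euclidean. A
  non-Euclidean rotational norm in dimension at least 3 determines its equator. Comparing the
  structures that \<open>x\<^sup>\<bottom>\<close> and \<open>w\<^sup>\<bottom>\<close> induce on \<open>x\<^sup>\<bottom> \<inter> w\<^sup>\<bottom>\<close> shows that \<open>e\<^sub>w\<close> lies in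
  \<open>span {x, w, e\<^sub>x}\<close> unless \<open>F\<close> is Euclidean there, so that the planes \<open>P\<^sub>x = span {x, e\<^sub>x}\<close> and
  \<open>P\<^sub>w\<close> have a common line. If \<open>P\<^sub>x\<close> and \<open>P\<^sub>y\<close> met only in 0, then a vector \<open>w\<close> outside
  \<open>P\<^sub>x + P\<^sub>y\<close> (here the dimension must be at least 5), chosen such that both intersections are
  non-Euclidean, would give a plane \<open>P\<^sub>w\<close> inside \<open>P\<^sub>x + P\<^sub>y\<close>. So any two of the planes meet, and
  since they cover the space they share a vector \<open>p\<close>. Then \<open>F\<close> is Euclidean on
  \<open>{z, p}\<^sup>\<bottom>\<close> for every \<open>z\<close> orthogonal to \<open>p\<close>, hence on \<open>p\<^sup>\<bottom>\<close>, a contradiction. One Euclidean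
  restriction makes \<open>K\<close>, therefore all restrictions and finally \<open>F\<close> itself, Euclidean.\<close>

section \<open>Invariant quadratic forms\<close>

text \<open>The fixed point minimises the norm \<open>x \<mapsto> SUP T\<in>\<T>. norm (T x)\<close> on \<open>C\<close>; by the parallelogram
  law this norm is strictly convex, so the minimiser is unique.\<close>

lemma common_fixed_point:
  fixes \<T> :: "('b::euclidean_space \<Rightarrow> 'b) set"
  assumes lin: "\<And>T. T \<in> \<T> \<Longrightarrow> linear T" and id: "id \<in> \<T>"
    and comp: "\<And>S T. S \<in> \<T> \<Longrightarrow> T \<in> \<T> \<Longrightarrow> S \<circ> T \<in> \<T>"
    and inv: "\<And>T. T \<in> \<T> \<Longrightarrow> \<exists>S\<in>\<T>. S \<circ> T = id"
    and bdd: "\<And>T x. T \<in> \<T> \<Longrightarrow> norm (T x) \<le> K * norm x"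
    and C: "closed C" "convex C" "C \<noteq> {}"
    and stable: "\<And>T x. T \<in> \<T> \<Longrightarrow> x \<in> C \<Longrightarrow> T x \<in> C"
  shows "\<exists>x\<in>C. \<forall>T\<in>\<T>. T x = x"
proof -
  define p where "p x = (SUP T\<in>\<T>. norm (T x))" for x
  have ba: "bdd_above ((\<lambda>T. norm (T x)) ` \<T>)" for x
    using bdd by (auto intro!: bdd_aboveI[where M="K * norm x"])
  have pge: "norm (T x) \<le> p x" if "T \<in> \<T>" for T x
    unfolding p_def by (rule cSUP_upper[OF that ba])
  have ple: "p x \<le> c" if "\<And>T. T \<in> \<T> \<Longrightarrow> norm (T x) \<le> c" for x c
    unfolding p_def using id that by (intro cSUP_least) auto
  have pnorm: "norm x \<le> p x" for x using pge[OF id, of x] by simp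
  have K0: "K > 0"
  proof -
    obtain x :: 'b where "norm x = 1" using vector_choose_size[of 1] by auto
    with bdd[OF id, of x] show ?thesis by simp
  qed
  have lip: "p x \<le> p y + K * norm (x - y)" for x y
  proof (rule ple)
    fix T assume T: "T \<in> \<T>"
    have "norm (T x) \<le> norm (T y) + norm (T (x - y))"
      using norm_triangle_ineq[of "T y" "T (x-y)"] by (simp add: linear_diff[OF lin[OF T]])
    thus "norm (T x) \<le> p y + K * norm (x - y)"
      using pge[OF T, of y] bdd[OF T, of "x-y"] by linarith
  qed
  have cont: "continuous_on S p" for S
  proof (rule continuous_on_subset)
    show "continuous_on UNIV p"
      unfolding continuous_on_iff
    proof (intro ballI allI impI)
      fix x and e :: real assume "e > 0"
      show "\<exists>d>0. \<forall>x'\<in>UNIV. dist x' x < d \<longrightarrow> dist (p x') (p x) < e"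
      proof (intro exI conjI ballI impI)
        show "e / K > 0" using K0 \<open>e > 0\<close> by simp
        fix x' assume "dist x' x < e / K"
        hence "K * norm (x' - x) < e" using K0 by (simp add: dist_norm field_simps)
        moreover have "\<bar>p x' - p x\<bar> \<le> K * norm (x' - x)"
          using lip[of x x'] lip[of x' x] by (simp add: norm_minus_commute abs_le_iff)
        ultimately show "dist (p x') (p x) < e" by (simp add: dist_real_def)
      qed
    qed
  qed simp
  obtain c where c: "c \<in> C" using C by blast
  \<comment> \<open>Since \<open>norm x \<le> p x\<close>, points of \<open>C\<close> outside this
    ball cannot do better than \<open>c\<close>, so it suffices to minimise over a compact
    set.\<close>
  have "compact (C \<inter> cball 0 (p c))" using C(1) by (simp add: closed_Int_compact)
  moreover have "c \<in> C \<inter> cball 0 (p c)" using c pnorm by simp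
  ultimately obtain x where x: "x \<in> C \<inter> cball 0 (p c)"
    and xmin: "\<And>y. y \<in> C \<inter> cball 0 (p c) \<Longrightarrow> p x \<le> p y"
    using continuous_attains_inf[OF _ _ cont] by (metis empty_iff)
  have min: "p x \<le> p y" if "y \<in> C" for y
  proof (cases "norm y \<le> p c")
    case True thus ?thesis using that xmin by simp
  next
    case False
    have "p x \<le> p c" using xmin c pnorm by simp
    thus ?thesis using pnorm[of y] False by simp
  qed
  have "T x = x" if T: "T \<in> \<T>" for T
  proof (rule ccontr)
    assume ne: "T x \<noteq> x"
    define y where "y = T x"
    have yC: "y \<in> C" using stable[OF T] x y_def by simp
    have py: "p y \<le> p x"
      by (rule ple) (use pge[OF comp[OF _ T]] in \<open>simp add: y_def\<close>)
    define m where "m = (1/2) *\<^sub>R x + (1/2) *\<^sub>R y"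
    have mC: "m \<in> C" unfolding m_def using C(2) x yC by (intro convexD) auto
    \<comment> \<open>\<open>p\<close> is a supremum, so the gain at the midpoint must be uniform in
      \<open>S\<close>. It is, because the inverse of \<open>S\<close> is bounded by
      \<open>K\<close>, which bounds \<open>norm (S (x - y))\<close> from below.\<close>
    define \<delta> where "\<delta> = (norm (x - y) / K)\<^sup>2 / 4"
    have \<delta>: "\<delta> > 0" using ne K0 by (simp add: \<delta>_def y_def)
    have key: "(norm (S m))\<^sup>2 \<le> (p x)\<^sup>2 - \<delta>" if S: "S \<in> \<T>" for S
    proof -
      have Sx: "(norm (S x))\<^sup>2 \<le> (p x)\<^sup>2" using pge[OF S] by (simp add: power_mono)
      have Sy: "(norm (S y))\<^sup>2 \<le> (p x)\<^sup>2"
        using pge[OF S, of y] py by (intro power_mono) auto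
      obtain R where R: "R \<in> \<T>" "R \<circ> S = id" using inv[OF S] by blast
      have "norm (x - y) \<le> K * norm (S (x - y))"
        using bdd[OF R(1), of "S (x-y)"] R(2) by (metis comp_apply id_apply)
      hence "norm (x - y) / K \<le> norm (S (x - y))" using K0 by (simp add: field_simps)
      hence "(norm (x - y) / K)\<^sup>2 \<le> (norm (S (x - y)))\<^sup>2" using K0 by (intro power_mono) auto
      hence d: "4 * \<delta> \<le> (norm (S x - S y))\<^sup>2" by (simp add: \<delta>_def linear_diff[OF lin[OF S]])
      have Sm: "S m = (1/2) *\<^sub>R (S x + S y)"
        by (simp add: m_def linear_add[OF lin[OF S]] linear_scale[OF lin[OF S]] scaleR_add_right)
      have "4 * (norm (S m))\<^sup>2 = (norm (S x + S y))\<^sup>2" unfolding Sm by (simp only: norm_scaleR power_mult_distrib) (simp add: power2_eq_square)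
      also have "\<dots> = 2 * (norm (S x))\<^sup>2 + 2 * (norm (S y))\<^sup>2 - (norm (S x - S y))\<^sup>2"
        by (simp add: power2_norm_eq_inner inner_simps inner_commute)
      finally show ?thesis using Sx Sy d by simp
    qed
    have "p m \<le> sqrt ((p x)\<^sup>2 - \<delta>)"
      by (rule ple) (use key real_le_rsqrt in blast)
    also have "\<dots> < sqrt ((p x)\<^sup>2)" using \<delta> by (intro real_sqrt_less_mono) simp
    also have "\<dots> = p x" using order_trans[OF norm_ge_zero pnorm] by simp
    finally show False using min[OF mC] by simp
  qed
  thus ?thesis using x by blast
qed

section \<open>Norm-like functions, definite forms and rotational symmetry\<close>

definition norm_like :: "('a::euclidean_space \<Rightarrow> real) \<Rightarrow> bool" where
  "norm_like F \<longleftrightarrow> continuous_on UNIV F \<and> (\<forall>x. x \<noteq> 0 \<longrightarrow> F x > 0) \<and> (\<forall>c x. F (c *\<^sub>R x) = \<bar>c\<bar> * F x)"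

text \<open>Only definiteness is relative to \<open>D\<close>. The form itself lives on the whole
  space, so it can be restricted to smaller subspaces unchanged.\<close>

definition pd_form :: "'a::euclidean_space set \<Rightarrow> ('a \<Rightarrow> 'a \<Rightarrow> real) \<Rightarrow> bool" where
  "pd_form D b \<longleftrightarrow> bilinear b \<and> (\<forall>x y. b x y = b y x) \<and> (\<forall>x\<in>D. x \<noteq> 0 \<longrightarrow> b x x > 0)"

text \<open>The axis is encoded by the functional \<open>e \<bullet> x\<close> on \<open>D\<close>:
  its level sets are the latitudes and its kernel is the equator. The vector \<open>e\<close> need
  not lie in \<open>D\<close>.\<close>

definition rotational ::
  "('a::euclidean_space \<Rightarrow> real) \<Rightarrow> 'a set \<Rightarrow> 'a \<Rightarrow> ('a \<Rightarrow> 'a \<Rightarrow> real) \<Rightarrow> bool" where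
  "rotational F D e b \<longleftrightarrow>
     pd_form D b \<and> (\<forall>x\<in>D. \<forall>y\<in>D. e \<bullet> x = e \<bullet> y \<and> b x x = b y y \<longrightarrow> F x = F y)"

definition parallelogram :: "('a::euclidean_space \<Rightarrow> real) \<Rightarrow> 'a set \<Rightarrow> bool" where
  "parallelogram F D \<longleftrightarrow>
     (\<forall>x\<in>D. \<forall>y\<in>D. (F (x + y))\<^sup>2 + (F (x - y))\<^sup>2 = 2 * (F x)\<^sup>2 + 2 * (F y)\<^sup>2)"

lemma norm_like_zero: "norm_like F \<Longrightarrow> F 0 = 0"
  unfolding norm_like_def by (metis abs_zero mult_zero_left scaleR_zero_left)

lemma norm_like_scale: "norm_like F \<Longrightarrow> F (c *\<^sub>R x) = \<bar>c\<bar> * F x"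
  unfolding norm_like_def by blast

lemma norm_like_pos: "norm_like F \<Longrightarrow> x \<noteq> 0 \<Longrightarrow> F x > 0"
  unfolding norm_like_def by blast

lemma norm_like_nonneg: "norm_like F \<Longrightarrow> F x \<ge> 0"
  by (cases "x = 0") (auto simp: norm_like_zero dest: norm_like_pos[of F x])

lemma norm_like_continuous_on: "norm_like F \<Longrightarrow> continuous_on S F"
  unfolding norm_like_def using continuous_on_subset by blast

lemma norm_like_bounds:
  fixes F :: "'a::euclidean_space \<Rightarrow> real"
  assumes "norm_like F"
  obtains c C where "c > 0" "\<And>x. c * norm x \<le> F x" "\<And>x. F x \<le> C * norm x"
proof -
  have ne: "sphere (0::'a) 1 \<noteq> {}" using vector_choose_size[of 1] by fastforce
  obtain u where u: "u \<in> sphere 0 1" "\<And>x. x \<in> sphere 0 1 \<Longrightarrow> F u \<le> F x"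
    using continuous_attains_inf[OF compact_sphere ne norm_like_continuous_on[OF assms]] by blast
  obtain v where v: "v \<in> sphere 0 1" "\<And>x. x \<in> sphere 0 1 \<Longrightarrow> F x \<le> F v"
    using continuous_attains_sup[OF compact_sphere ne norm_like_continuous_on[OF assms]] by blast
  have sc: "F x = norm x * F (x /\<^sub>R norm x) \<and> x /\<^sub>R norm x \<in> sphere 0 1" if "x \<noteq> 0" for x
    using norm_like_scale[OF assms, of "norm x" "x /\<^sub>R norm x"] that by simp
  have "F u * norm x \<le> F x \<and> F x \<le> F v * norm x" for x
  proof (cases "x = 0")
    case True thus ?thesis by (simp add: norm_like_zero[OF assms])
  next
    case False
    show ?thesis using sc[OF False] u(2) v(2) by (metis mult.commute mult_left_mono norm_ge_zero)
  qed
  moreover have "F u > 0" using u(1) norm_like_pos[OF assms, of u] by force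
  ultimately show thesis using that by blast
qed

lemma norm_like_isometry_bij:
  fixes g :: "'a::euclidean_space \<Rightarrow> 'a"
  assumes F: "norm_like F" and g: "linear g" and iso: "\<And>x. F (g x) = F x"
  shows "\<exists>h. linear h \<and> h \<circ> g = id \<and> g \<circ> h = id"
proof -
  have "inj g"
    unfolding linear_injective_0[OF g]
    using iso norm_like_pos[OF F] norm_like_zero[OF F] by (metis less_irrefl)
  then obtain h where h: "linear h" "h \<circ> g = id"
    using linear_injective_left_inverse[OF g] by blast
  thus ?thesis using linear_inverse_left[OF h(1) g] by blast
qed

lemma add_matrix_mult: "(A + B) ** C = A ** C + B ** (C :: real^'p^'n)" for A B :: "real^'n^'m"
  by (simp add: vec_eq_iff matrix_matrix_mult_def distrib_right sum.distrib)

text \<open>Forms are encoded as matrices; an isometry \<open>g\<close> acts by pulling back.\<close>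

lemma ex_invariant_form:
  fixes F :: "real ^ 'm \<Rightarrow> real"
  assumes F: "norm_like F"
  shows "\<exists>b. pd_form UNIV b \<and>
    (\<forall>g. linear g \<and> (\<forall>x. F (g x) = F x) \<longrightarrow> (\<forall>x y. b (g x) (g y) = b x y))"
proof -
  define G :: "(real^'m \<Rightarrow> real^'m) set" where "G = {g. linear g \<and> (\<forall>x. F (g x) = F x)}"
  define T :: "(real^'m \<Rightarrow> real^'m) \<Rightarrow> real^'m^'m \<Rightarrow> real^'m^'m"
    where "T g Q = transpose (matrix g) ** Q ** matrix g" for g Q
  \<comment> \<open>A closed convex condition preserved under pulling back by isometries of
    \<open>F\<close>; it makes the fixed point positive definite.\<close>
  define C where "C = {Q::real^'m^'m. transpose Q = Q \<and> (\<forall>x. (F x)\<^sup>2 \<le> x \<bullet> (Q *v x))}"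
  obtain k M where kM: "k > 0" "\<And>x. k * norm x \<le> F x" "\<And>x. F x \<le> M * norm x"
    using norm_like_bounds[OF F] by blast
  have Tform: "x \<bullet> (T g Q *v y) = g x \<bullet> (Q *v g y)" if "linear g" for g Q x y
  proof -
    have "T g Q *v y = transpose (matrix g) *v (Q *v (matrix g *v y))"
      by (simp only: T_def matrix_vector_mul_assoc matrix_mul_assoc)
    also have "x \<bullet> \<dots> = (x v* transpose (matrix g)) \<bullet> (Q *v (matrix g *v y))"
      by (simp only: dot_lmul_matrix)
    finally show ?thesis by (simp only: vector_transpose_matrix fun_cong[OF matrix_vector_mul(2)[OF that]])
  qed
  have Tcomp: "T g \<circ> T h = T (h \<circ> g)" if "linear g" "linear h" for g h
    by (rule ext) (simp add: T_def matrix_compose[OF that] matrix_transpose_mul matrix_mul_assoc)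
  have Gcomp: "g \<circ> h \<in> G" if "g \<in> G" "h \<in> G" for g h
    using that by (simp add: G_def linear_compose)
  have idG: "id \<in> G" by (simp add: G_def linear_id)
  have Tid: "T id = id" by (rule ext) (simp add: T_def matrix_id_mat_1 transpose_mat)
  have bil: "bounded_bilinear ((**) :: real^'m^'m \<Rightarrow> real^'m^'m \<Rightarrow> real^'m^'m)"
    unfolding bilinear_conv_bounded_bilinear[symmetric]
    by (auto simp: bilinear_def linear_iff matrix_add_ldistrib add_matrix_mult
        scalar_matrix_assoc matrix_scalar_ac)
  obtain c where c0: "c > 0" and c': "\<forall>A B. norm ((A :: real^'m^'m) ** (B :: real^'m^'m)) \<le> norm A * norm B * c"
    using bounded_bilinear.pos_bounded[OF bil] by (elim exE conjE)
  note c = c0 c'[rule_format]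
  have norm_entries: "norm A \<le> real CARD('m) * (real CARD('m) * R)"
    if "\<And>i j. \<bar>A $ i $ j\<bar> \<le> R" for A :: "real^'m^'m" and R
  proof -
    have "norm A \<le> (\<Sum>i\<in>UNIV. norm (A $ i))"
      unfolding norm_vec_def by (rule L2_set_le_sum) simp
    also have "\<dots> \<le> (\<Sum>i\<in>(UNIV::'m set). real CARD('m) * R)"
    proof (rule sum_mono)
      fix i
      have "norm (A $ i) \<le> (\<Sum>j\<in>UNIV. \<bar>A $ i $ j\<bar>)" by (rule norm_le_l1_cart)
      also have "\<dots> \<le> (\<Sum>j\<in>(UNIV::'m set). R)" by (rule sum_mono) (rule that)
      finally show "norm (A $ i) \<le> real CARD('m) * R" by simp
    qed
    finally show ?thesis by simp
  qed
  \<comment> \<open>Isometries are uniformly bounded: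
    \<open>k * norm (g v) \<le> F (g v) = F v \<le> M * norm v\<close>, which bounds every matrix
    entry by \<open>M / k\<close>.\<close>
  define N where "N = real CARD('m) * (real CARD('m) * (M / k))"
  have N: "norm (matrix g) \<le> N \<and> norm (transpose (matrix g)) \<le> N" if "g \<in> G" for g
  proof -
    have "\<bar>matrix g $ i $ j\<bar> \<le> M / k" for i j
    proof -
      have "\<bar>matrix g $ i $ j\<bar> \<le> norm (g (axis j 1))"
        by (simp add: matrix_def component_le_norm_cart)
      also have "\<dots> \<le> F (g (axis j 1)) / k" using kM by (simp add: field_simps mult.commute)
      also have "F (g (axis j 1)) = F (axis j 1)" using that by (simp add: G_def)
      also have "F (axis j 1) / k \<le> M / k"
        using kM(1) kM(3)[of "axis j 1"] by (simp add: divide_right_mono)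
      finally show ?thesis .
    qed
    thus ?thesis
      unfolding N_def by (intro conjI norm_entries) (simp_all only: transpose_def vec_lambda_beta)
  qed
  have N0: "N \<ge> 0" using N[OF idG] norm_ge_zero order_trans by blast
  have "\<exists>Q\<in>C. \<forall>f\<in>T ` G. f Q = Q"
  proof (rule common_fixed_point)
    show "linear f" if f: "f \<in> T ` G" for f
    proof -
      obtain g where g: "f = T g" using f by blast
      show ?thesis unfolding g T_def
        by (auto simp: linear_iff matrix_add_ldistrib add_matrix_mult
            scalar_matrix_assoc[symmetric] matrix_scalar_ac)
    qed
    show "id \<in> T ` G" using Tid idG by (metis imageI)
    show "f \<circ> h \<in> T ` G" if f: "f \<in> T ` G" and h: "h \<in> T ` G" for f h
    proof -
      obtain g1 where g1: "g1 \<in> G" "f = T g1" using f by blast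
      obtain g2 where g2: "g2 \<in> G" "h = T g2" using h by blast
      have "f \<circ> h = T (g2 \<circ> g1)" using Tcomp g1 g2 by (simp add: G_def)
      thus ?thesis using Gcomp[OF g2(1) g1(1)] by blast
    qed
    show "\<exists>h\<in>T ` G. h \<circ> f = id" if f: "f \<in> T ` G" for f
    proof -
      obtain g where g: "g \<in> G" "f = T g" using f by blast
      obtain h where h: "linear h" "h \<circ> g = id" "g \<circ> h = id"
        using norm_like_isometry_bij[OF F] g(1) unfolding G_def by blast
      have "F (h x) = F x" for x
        using g(1) h(3) unfolding G_def by (metis (mono_tags) comp_apply id_apply mem_Collect_eq)
      hence "h \<in> G" using h(1) by (simp add: G_def)
      moreover have "T h \<circ> f = id" using g h Tcomp Tid by (simp add: G_def)
      ultimately show ?thesis by blast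
    qed
    show "norm (f Q) \<le> N * c * N * c * norm Q" if f: "f \<in> T ` G" for f Q
    proof -
      obtain g where g: "g \<in> G" "f = T g" using f by blast
      have "norm (f Q) \<le> norm (transpose (matrix g) ** Q) * norm (matrix g) * c"
        unfolding g T_def by (rule c)
      also have "\<dots> \<le> (norm (transpose (matrix g)) * norm Q * c) * norm (matrix g) * c"
        using c by (intro mult_right_mono c) auto
      also have "\<dots> \<le> (N * norm Q * c) * N * c"
        using N[OF g(1)] N0 c(1) by (intro mult_right_mono mult_mono) auto
      finally show ?thesis by (simp add: mult_ac)
    qed
    have Q1: "continuous_on UNIV (\<lambda>Q::real^'m^'m. x \<bullet> (Q *v x))" for x
      unfolding matrix_vector_mult_def by (intro continuous_intros)
    have Q2: "continuous_on UNIV (\<lambda>Q::real^'m^'m. transpose Q)"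
      unfolding transpose_def by (intro continuous_intros)
    have "C = {Q. transpose Q = Q} \<inter> (\<Inter>x. {Q. (F x)\<^sup>2 \<le> x \<bullet> (Q *v x)})" by (auto simp: C_def)
    also have "closed \<dots>"
      by (intro closed_Int closed_INT ballI closed_Collect_eq closed_Collect_le Q1 Q2
          continuous_on_const continuous_on_id)
    finally show "closed C" .
    show "convex C"
    proof (rule convexI)
      fix P Q :: "real^'m^'m" and u v :: real
      assume *: "P \<in> C" "Q \<in> C" "0 \<le> u" "0 \<le> v" "u + v = 1"
      have "(F x)\<^sup>2 \<le> x \<bullet> ((u *\<^sub>R P + v *\<^sub>R Q) *v x)" for x
      proof -
        have "(F x)\<^sup>2 = u * (F x)\<^sup>2 + v * (F x)\<^sup>2" using * by (metis distrib_right mult_1)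
        also have "\<dots> \<le> u * (x \<bullet> (P *v x)) + v * (x \<bullet> (Q *v x))"
          using * by (intro add_mono mult_left_mono) (auto simp: C_def)
        also have "\<dots> = x \<bullet> ((u *\<^sub>R P + v *\<^sub>R Q) *v x)"
          by (simp add: matrix_vector_mult_add_rdistrib scaleR_matrix_vector_assoc[symmetric] inner_simps)
        finally show ?thesis .
      qed
      thus "u *\<^sub>R P + v *\<^sub>R Q \<in> C"
        using * by (simp add: C_def transpose_def vec_eq_iff)
    qed
    have "(M\<^sup>2) *\<^sub>R mat 1 \<in> C"
    proof -
      have "(F x)\<^sup>2 \<le> x \<bullet> (((M\<^sup>2) *\<^sub>R mat 1) *v x)" for x
      proof -
        have "(F x)\<^sup>2 \<le> (M * norm x)\<^sup>2" by (intro power_mono kM norm_like_nonneg[OF F])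
        thus ?thesis
          by (simp add: scaleR_matrix_vector_assoc[symmetric] power_mult_distrib power2_norm_eq_inner)
      qed
      thus ?thesis by (simp add: C_def transpose_def vec_eq_iff mat_def eq_commute)
    qed
    thus "C \<noteq> {}" by blast
    show "f Q \<in> C" if f: "f \<in> T ` G" and Q: "Q \<in> C" for f Q
    proof -
      obtain g where g: "g \<in> G" "f = T g" using f by blast
      have "(F x)\<^sup>2 \<le> x \<bullet> (f Q *v x)" for x
        using g Q Tform[of g x Q x] by (simp add: G_def C_def) metis
      moreover have "transpose (f Q) = f Q"
        using Q by (simp add: g(2) T_def C_def matrix_transpose_mul matrix_mul_assoc)
      ultimately show ?thesis by (simp add: C_def)
    qed
  qed
  then obtain Q where Q: "Q \<in> C" "\<And>g. g \<in> G \<Longrightarrow> T g Q = Q" by blast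
  define b where "b x y = x \<bullet> (Q *v y)" for x y
  have "bilinear b"
    by (auto simp: bilinear_def linear_iff b_def inner_simps matrix_vector_right_distrib
        matrix_vector_mult_scaleR)
  moreover have "b x y = b y x" for x y
  proof -
    have "x \<bullet> (Q *v y) = (x v* Q) \<bullet> y" by (rule dot_lmul_matrix[symmetric])
    also have "x v* Q = Q *v x" using Q(1) by (metis (mono_tags) C_def mem_Collect_eq transpose_matrix_vector)
    finally show ?thesis by (simp add: b_def inner_commute)
  qed
  moreover have "b x x > 0" if "x \<noteq> 0" for x
  proof -
    have "0 < (F x)\<^sup>2" using norm_like_pos[OF F that] by simp
    also have "\<dots> \<le> b x x" using Q(1) by (simp add: b_def C_def)
    finally show ?thesis .
  qed
  moreover have "b (g x) (g y) = b x y" if "linear g" "\<forall>x. F (g x) = F x" for g x y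
    using Q(2)[of g] Tform[OF that(1), of x Q y] that by (simp add: b_def G_def)
  ultimately show ?thesis unfolding pd_form_def by blast
qed

lemma pd_formD:
  assumes "pd_form D b"
  shows "bilinear b" and "b x y = b y x" and "x \<in> D \<Longrightarrow> x \<noteq> 0 \<Longrightarrow> b x x > 0"
    and "x \<in> D \<Longrightarrow> b x x \<ge> 0"
proof -
  show b: "bilinear b" "b x y = b y x" and pos: "x \<in> D \<Longrightarrow> x \<noteq> 0 \<Longrightarrow> b x x > 0"
    using assms unfolding pd_form_def by blast+
  show "x \<in> D \<Longrightarrow> b x x \<ge> 0"
    using pos bilinear_lzero[OF b(1), of x] by (cases "x = 0") auto
qed

lemma rotationalD:
  assumes "rotational F D e b"
  shows "pd_form D b"
    and "x \<in> D \<Longrightarrow> y \<in> D \<Longrightarrow> e \<bullet> x = e \<bullet> y \<Longrightarrow> b x x = b y y \<Longrightarrow> F x = F y"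
  using assms unfolding rotational_def by blast+

lemma orthogonal_projection_props:
  fixes H :: "'a::euclidean_space set"
  assumes H: "subspace H"
  shows orthogonal_projection_in: "orthogonal_projection H x \<in> H"
    and orthogonal_projection_inner: "y \<in> H \<Longrightarrow> orthogonal_projection H x \<bullet> y = x \<bullet> y"
    and orthogonal_projection_id: "x \<in> H \<Longrightarrow> orthogonal_projection H x = x"
    and linear_orthogonal_projection: "linear (orthogonal_projection H)"
proof -
  note eq = orthogonal_projection_eq_iff[OF H]
  have P: "orthogonal_projection H x \<in> H" "x - orthogonal_projection H x \<in> H\<^sup>\<bottom>" for x
    using eq[of x "orthogonal_projection H x"] by auto
  show "orthogonal_projection H x \<in> H" by (rule P)
  show "orthogonal_projection H x \<bullet> y = x \<bullet> y" if "y \<in> H"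
    using P(2)[of x] that by (auto simp: orthogonal_comp_def orthogonal_def inner_diff_right inner_commute)
  show "orthogonal_projection H x = x" if "x \<in> H"
    using that subspace_0[OF subspace_orthogonal_comp[of H]] by (simp add: eq)
  show "linear (orthogonal_projection H)"
  proof (rule linearI)
    fix x y
    have "(x - orthogonal_projection H x) + (y - orthogonal_projection H y) \<in> H\<^sup>\<bottom>"
      by (intro subspace_add[OF subspace_orthogonal_comp] P)
    thus "orthogonal_projection H (x + y) = orthogonal_projection H x + orthogonal_projection H y"
      unfolding eq by (simp add: P subspace_add[OF H] algebra_simps)
  next
    fix c x
    have "c *\<^sub>R (x - orthogonal_projection H x) \<in> H\<^sup>\<bottom>"
      by (intro subspace_scale[OF subspace_orthogonal_comp] P)
    thus "orthogonal_projection H (c *\<^sub>R x) = c *\<^sub>R orthogonal_projection H x"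
      unfolding eq by (simp add: P subspace_scale[OF H] algebra_simps)
  qed
qed

text \<open>\<open>F\<close> on \<open>D\<close> is extended to \<open>F'\<close> by means of the
  Euclidean norm on the orthogonal complement. An isometry of \<open>F\<close> on \<open>D\<close>,
  extended by the identity on the complement, preserves \<open>F'\<close>, so a form invariant for
  \<open>F'\<close> serves.\<close>

lemma ex_invariant_form_on:
  fixes F :: "real ^ 'm \<Rightarrow> real"
  assumes F: "norm_like F" and D: "subspace D"
  shows "\<exists>b. pd_form UNIV b \<and>
    (\<forall>g. linear g \<and> (\<forall>x\<in>D. g x \<in> D \<and> F (g x) = F x) \<longrightarrow> (\<forall>x\<in>D. \<forall>y\<in>D. b (g x) (g y) = b x y))"
proof -
  define P where "P = orthogonal_projection D"
  have P: "P x \<in> D" "x \<in> D \<Longrightarrow> P x = x" "linear P" for x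
    unfolding P_def using orthogonal_projection_props[OF D] by auto
  define F' where "F' x = F (P x) + norm (x - P x)" for x
  have "norm_like F'"
    unfolding norm_like_def
  proof (intro conjI allI impI)
    have cP: "continuous_on UNIV P"
      using P(3) by (simp add: linear_continuous_on linear_conv_bounded_linear)
    have "continuous_on UNIV (F \<circ> P)"
      by (rule continuous_on_compose[OF cP norm_like_continuous_on[OF F]])
    thus "continuous_on UNIV F'"
      unfolding F'_def o_def using cP by (intro continuous_on_add continuous_on_norm continuous_on_diff continuous_on_id)
    show "F' x > 0" if "x \<noteq> 0" for x
    proof (cases "P x = 0")
      case True thus ?thesis using that by (simp add: F'_def norm_like_zero[OF F])
    next
      case False
      have "norm (x - P x) \<ge> 0" by simp
      thus ?thesis using norm_like_pos[OF F False] unfolding F'_def by linarith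
    qed
    show "F' (c *\<^sub>R x) = \<bar>c\<bar> * F' x" for c x
    proof -
      have "c *\<^sub>R x - P (c *\<^sub>R x) = c *\<^sub>R (x - P x)" by (simp add: linear_scale[OF P(3)] scaleR_diff_right)
      thus ?thesis by (simp add: F'_def linear_scale[OF P(3)] norm_like_scale[OF F] distrib_left)
    qed
  qed
  then obtain b where b: "pd_form UNIV b"
    and inv: "\<And>g x y. linear g \<Longrightarrow> (\<And>x. F' (g x) = F' x) \<Longrightarrow> b (g x) (g y) = b x y"
    using ex_invariant_form by (metis (no_types, lifting))
  have "b (g x) (g y) = b x y"
    if g: "linear g" "\<And>x. x \<in> D \<Longrightarrow> g x \<in> D \<and> F (g x) = F x" and xy: "x \<in> D" "y \<in> D" for g x y
  proof -
    define h where "h x = g (P x) + (x - P x)" for x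
    have "linear h"
      by (rule linearI)
        (simp_all add: h_def linear_add[OF P(3)] linear_add[OF g(1)] linear_scale[OF P(3)]
          linear_scale[OF g(1)] algebra_simps)
    moreover have "F' (h x) = F' x" for x
    proof -
      have "P (h x) = g (P x)"
        using P g(2) by (simp add: h_def linear_add[OF P(3)] linear_diff[OF P(3)])
      thus ?thesis using P g(2) by (simp add: F'_def h_def)
    qed
    ultimately have "b (h x) (h y) = b x y" by (rule inv)
    thus ?thesis using P(2) xy by (simp add: h_def)
  qed
  thus ?thesis using b by blast
qed

text \<open>Riesz representation with respect to \<open>b\<close>: the Gram operator compressed to
  \<open>D\<close> is injective, hence onto. For a rotational structure, \<open>a\<close> spans the
  axis, the \<open>b\<close>-orthogonal complement of the equator.\<close>

lemma pd_form_representer: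
  fixes D :: "'a::euclidean_space set"
  assumes D: "subspace D" and b: "pd_form D b"
  shows "\<exists>a\<in>D. \<forall>x\<in>D. b a x = e \<bullet> x"
proof -
  have bil: "bilinear b" using b by (simp add: pd_form_def)
  define P where "P = orthogonal_projection D"
  note P = orthogonal_projection_props[OF D, folded P_def]
  define M where "M a = (\<Sum>i\<in>Basis. b a i *\<^sub>R i)" for a
  have M: "M a \<bullet> x = b a x" for a x
  proof -
    have "b a x = b a (\<Sum>i\<in>Basis. (x \<bullet> i) *\<^sub>R i)" by (simp add: euclidean_representation)
    also have "\<dots> = (\<Sum>i\<in>Basis. (x \<bullet> i) * b a i)"
      using bil by (simp add: bilinear_def linear_sum linear_scale)
    finally show ?thesis by (simp add: M_def inner_sum_left inner_sum_right inner_commute mult.commute)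
  qed
  have "linear M"
    by (rule linearI)
      (simp_all add: M_def bilinear_ladd[OF bil] bilinear_lmul[OF bil] scaleR_add_left sum.distrib scaleR_sum_right)
  hence lin: "linear (P \<circ> M)" using P(4) by (simp add: linear_compose)
  have inn: "(P \<circ> M) a \<bullet> x = b a x" if "x \<in> D" for a x using P(2)[OF that] M by simp
  have "inj_on (P \<circ> M) D"
    unfolding linear_injective_on_subspace_0[OF lin D]
  proof (intro ballI impI)
    fix a assume a: "a \<in> D" "(P \<circ> M) a = 0"
    hence "b a a = 0" using inn[OF a(1), of a] by simp
    thus "a = 0" using b a(1) unfolding pd_form_def by force
  qed
  hence "dim ((P \<circ> M) ` D) = dim D" using dim_image_eq[OF lin] D by (metis span_eq_iff)
  moreover have "(P \<circ> M) ` D \<subseteq> D" using P(1) by auto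
  ultimately have "(P \<circ> M) ` D = D"
    using subspace_dim_equal[OF linear_subspace_image[OF lin D] D] by simp
  then obtain a where "a \<in> D" "(P \<circ> M) a = P e" using P(1) by (metis (no_types, lifting) imageE)
  thus ?thesis using inn P(2) by metis
qed

section \<open>Quadratic restrictions of a rotational function\<close>

definition quadratic_on :: "('a::euclidean_space \<Rightarrow> real) \<Rightarrow> 'a set \<Rightarrow> bool" where
  "quadratic_on F D \<longleftrightarrow> (\<exists>q. bilinear q \<and> (\<forall>x y. q x y = q y x) \<and> (\<forall>x\<in>D. (F x)\<^sup>2 = q x x))"

lemma quadratic_on_parallelogram:
  assumes "quadratic_on F D" "subspace D"
  shows "parallelogram F D"
proof -
  obtain q where q: "bilinear q" "\<And>x. x \<in> D \<Longrightarrow> (F x)\<^sup>2 = q x x"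
    using assms unfolding quadratic_on_def by blast
  show ?thesis
    unfolding parallelogram_def
    by (simp add: q(2) subspace_add[OF assms(2)] subspace_diff[OF assms(2)] bilinear_ladd[OF q(1)]
        bilinear_radd[OF q(1)] bilinear_lsub[OF q(1)] bilinear_rsub[OF q(1)])
qed

lemma quadratic_on_of_form:
  assumes "bilinear b" "\<And>x y. b x y = b y x" "\<And>x. x \<in> D \<Longrightarrow> (F x)\<^sup>2 = c * b x x"
  shows "quadratic_on F D"
proof -
  note bs = bilinear_ladd[OF assms(1)] bilinear_radd[OF assms(1)] bilinear_lmul[OF assms(1)]
    bilinear_rmul[OF assms(1)]
  have "bilinear (\<lambda>x y. c * b x y)"
    by (simp add: bilinear_def linear_iff bs algebra_simps)
  moreover have "c * b x y = c * b y x" for x y by (simp only: assms(2)[of x y])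
  ultimately show ?thesis
    unfolding quadratic_on_def using assms(3) by blast
qed

text \<open>All of \<open>D\<close> has latitude 0, so \<open>F\<close> depends on
  \<open>b x x\<close> alone, and homogeneity makes its square a multiple of
  \<open>b x x\<close>.\<close>

lemma rotational_quadratic_equator:
  assumes F: "norm_like F" and D: "subspace D" and rot: "rotational F D e b"
    and e: "\<And>x. x \<in> D \<Longrightarrow> e \<bullet> x = 0"
  shows "quadratic_on F D"
proof -
  note b = pd_formD[OF rotationalD(1)[OF rot]]
  show ?thesis
  proof (cases "D \<subseteq> {0}")
    case True
    have "(F x)\<^sup>2 = 0 * b x x" if "x \<in> D" for x
      using True that norm_like_zero[OF F] by auto
    thus ?thesis by (rule quadratic_on_of_form[OF b(1,2)])
  next
    case False
    then obtain d where d: "d \<in> D" "d \<noteq> 0" by blast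
    show ?thesis
    proof (rule quadratic_on_of_form[OF b(1,2)])
      fix x assume x: "x \<in> D"
      note x0 = b(4)[OF x]
      define s where "s = sqrt (b x x / b d d)"
      have s: "s\<^sup>2 = b x x / b d d" using x0 b(3)[OF d] by (simp add: s_def)
      have "b (s *\<^sub>R d) (s *\<^sub>R d) = s\<^sup>2 * b d d"
        by (simp add: bilinear_lmul[OF b(1)] bilinear_rmul[OF b(1)] power2_eq_square)
      also have "\<dots> = b x x" using b(3)[OF d] by (simp add: s)
      finally have "F x = F (s *\<^sub>R d)"
        using x e d(1) subspace_scale[OF D d(1)] by (intro rotationalD(2)[OF rot]) auto
      thus "(F x)\<^sup>2 = ((F d)\<^sup>2 / b d d) * b x x"
        by (simp add: norm_like_scale[OF F] power_mult_distrib s)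
    qed
  qed
qed

text \<open>A section containing the axis \<open>a\<close> and one equatorial direction
  \<open>u\<close> decides about all of \<open>H\<close>: every \<open>x\<close> shares latitude and
  length with a vector \<open>t *\<^sub>R a + s *\<^sub>R u\<close> of the section and with its
  mirror image.\<close>

lemma rotational_quadratic_section:
  assumes F: "norm_like F" and H: "subspace H" and rot: "rotational F H e b"
    and a: "a \<in> H" "a \<noteq> 0" "\<And>x. x \<in> H \<Longrightarrow> b a x = e \<bullet> x"
    and D: "subspace D" "D \<subseteq> H" "a \<in> D" and u: "u \<in> D" "u \<noteq> 0" "e \<bullet> u = 0"
    and par: "parallelogram F D"
  shows "quadratic_on F H"
proof -
  note b = pd_formD[OF rotationalD(1)[OF rot]] and r = rotationalD(2)[OF rot]
  note bs = bilinear_ladd[OF b(1)] bilinear_radd[OF b(1)] bilinear_lsub[OF b(1)] bilinear_rsub[OF b(1)]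
    bilinear_lmul[OF b(1)] bilinear_rmul[OF b(1)]
  have uH: "u \<in> H" using u D by blast
  have ea: "b a a = e \<bullet> a" "e \<bullet> a > 0" using a b(3) by (auto simp flip: a(3))
  have bu: "b u u > 0" using b(3) u uH by blast
  have au: "b a u = 0" "b u a = 0" using a(3)[OF uH] u(3) b(2) by auto
  \<comment> \<open>The coefficients are forced by \<open>q u u = (F u)\<^sup>2\<close> and
    \<open>q a a = (F a)\<^sup>2\<close>.\<close>
  define \<beta> where "\<beta> = (F u)\<^sup>2 / b u u"
  define \<alpha> where "\<alpha> = ((F a)\<^sup>2 - (e \<bullet> a) * \<beta>) / (e \<bullet> a)\<^sup>2"
  define q where "q x y = \<alpha> * ((e \<bullet> x) * (e \<bullet> y)) + \<beta> * b x y" for x y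
  have "(F x)\<^sup>2 = q x x" if x: "x \<in> H" for x
  proof -
    define t where "t = (e \<bullet> x) / (e \<bullet> a)"
    define v where "v = x - t *\<^sub>R a"
    have vH: "v \<in> H" unfolding v_def using x a(1) H by (intro subspace_diff subspace_scale)
    have ev: "e \<bullet> v = 0" using ea by (simp add: v_def t_def inner_simps)
    hence av: "b a v = 0" "b v a = 0" using a(3)[OF vH] b(2) by auto
    have xv: "x = t *\<^sub>R a + v" by (simp add: v_def)
    have bxx: "b x x = t\<^sup>2 * (e \<bullet> a) + b v v"
      unfolding xv by (simp add: bs av ea power2_eq_square)
    note v0 = b(4)[OF vH]
    define s where "s = sqrt (b v v / b u u)"
    have s: "s\<^sup>2 = b v v / b u u" using v0 bu by (simp add: s_def)
    have mem: "t *\<^sub>R a \<in> D" "s *\<^sub>R u \<in> D" using D u by (auto intro: subspace_scale)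
    have memH: "t *\<^sub>R a + s *\<^sub>R u \<in> H" "t *\<^sub>R a - s *\<^sub>R u \<in> H"
      using mem D(2) H by (auto intro!: subspace_add subspace_diff)
    have ss: "b (t *\<^sub>R a + s *\<^sub>R u) (t *\<^sub>R a + s *\<^sub>R u) = t\<^sup>2 * (e \<bullet> a) + s\<^sup>2 * b u u"
       "b (t *\<^sub>R a - s *\<^sub>R u) (t *\<^sub>R a - s *\<^sub>R u) = t\<^sup>2 * (e \<bullet> a) + s\<^sup>2 * b u u"
      by (simp_all add: bs au ea power2_eq_square)
    have ex: "e \<bullet> x = t * (e \<bullet> a)" using ea by (simp add: t_def)
    \<comment> \<open>Both diagonals have the value \<open>F x\<close>, so the parallelogram law
      becomes a Pythagorean identity without a mixed term.\<close>
    have "F (t *\<^sub>R a + s *\<^sub>R u) = F x" "F (t *\<^sub>R a - s *\<^sub>R u) = F x"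
      using memH x ss bxx bu by (auto intro!: r simp: inner_simps u(3) ex s)
    hence "2 * (F x)\<^sup>2 = 2 * (F (t *\<^sub>R a))\<^sup>2 + 2 * (F (s *\<^sub>R u))\<^sup>2"
      using par mem unfolding parallelogram_def by (metis mult_2)
    hence "(F x)\<^sup>2 = t\<^sup>2 * (F a)\<^sup>2 + s\<^sup>2 * (F u)\<^sup>2"
      by (simp add: norm_like_scale[OF F] power_mult_distrib)
    also have "s\<^sup>2 * (F u)\<^sup>2 = \<beta> * (b x x - t\<^sup>2 * (e \<bullet> a))" by (simp add: bxx s \<beta>_def)
    finally have "(F x)\<^sup>2 = t\<^sup>2 * ((F a)\<^sup>2 - (e \<bullet> a) * \<beta>) + \<beta> * b x x"
      by (simp add: algebra_simps)
    also have "(F a)\<^sup>2 - (e \<bullet> a) * \<beta> = \<alpha> * (e \<bullet> a)\<^sup>2" using ea by (simp add: \<alpha>_def)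
    finally show ?thesis by (simp add: q_def ex power2_eq_square mult_ac)
  qed
  moreover have "bilinear q"
    by (simp add: q_def bilinear_def linear_iff inner_simps bs algebra_simps)
  ultimately show ?thesis
    unfolding quadratic_on_def by (intro exI[of _ q]) (auto simp: q_def b(2) mult.commute)
qed

text \<open>For \<open>d\<close> orthogonal to \<open>e\<close> the \<open>b'\<close>-reflection in \<open>d\<close> preserves \<open>F\<close>, hence \<open>b\<close>;
  a linear involution preserving \<open>b\<close> and negating \<open>d\<close> is the \<open>b\<close>-reflection in \<open>d\<close>.\<close>

lemma rotational_invariant_form:
  assumes D: "subspace D" and rot: "rotational F D e b'" and b: "pd_form D b"
    and inv: "\<And>g x y. linear g \<Longrightarrow> (\<And>x. x \<in> D \<Longrightarrow> g x \<in> D \<and> F (g x) = F x) \<Longrightarrow>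
      x \<in> D \<Longrightarrow> y \<in> D \<Longrightarrow> b (g x) (g y) = b x y"
  shows "rotational F D e b"
  unfolding rotational_def
proof (intro conjI b ballI impI)
  fix x y assume x: "x \<in> D" and y: "y \<in> D" and "e \<bullet> x = e \<bullet> y \<and> b x x = b y y"
  hence exy: "e \<bullet> x = e \<bullet> y" and bxy: "b x x = b y y" by auto
  note b' = pd_formD[OF rotationalD(1)[OF rot]] and r = rotationalD(2)[OF rot] and bb = pd_formD[OF b]
  note bs = bilinear_ladd bilinear_radd bilinear_lsub bilinear_rsub bilinear_lmul bilinear_rmul
    bilinear_rneg bilinear_lneg
  show "F x = F y"
  proof (cases "x = y")
    case False
    define d where "d = x - y"
    have d: "d \<in> D" "d \<noteq> 0" "e \<bullet> d = 0"
      using x y D False exy by (auto simp: d_def subspace_diff inner_simps)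
    have dd: "b' d d > 0" "b d d > 0" using b'(3) bb(3) d by auto
    define s where "s z = z - (2 * b' z d / b' d d) *\<^sub>R d" for z
    have lin: "linear s"
      by (rule linearI)
        (simp_all add: s_def bs[OF b'(1)] algebra_simps add_divide_distrib)
    have sD: "s z \<in> D \<and> F (s z) = F z" if z: "z \<in> D" for z
    proof -
      have "s z \<in> D" unfolding s_def using z d D by (intro subspace_diff subspace_scale)
      moreover have "b' (s z) (s z) = b' z z"
        using dd by (simp add: s_def bs[OF b'(1)] b'(2)[of d z] field_simps)
      ultimately show ?thesis using r[of "s z" z] z d by (simp add: s_def inner_simps)
    qed
    have sd: "s d = - d" using dd by (simp add: s_def scaleR_2[symmetric] algebra_simps)
    \<comment> \<open>As \<open>s d = - d\<close>, invariance of \<open>b\<close> determines the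
      coefficient of \<open>d\<close> in \<open>s x\<close>. Equality of the
      \<open>b\<close>-lengths of \<open>x\<close> and \<open>y\<close> makes it 1, so
      \<open>s\<close> carries \<open>x\<close> to \<open>y\<close>.\<close>
    have "b (s x) (s d) = b x d" using inv[OF lin sD] x d by blast
    hence "(2 * b' x d / b' d d) * b d d = 2 * b x d"
      unfolding sd by (simp add: s_def bs[OF bb(1)])
    also have "2 * b x d = b d d"
      using bxy by (simp add: d_def bs[OF bb(1)] bb(2)[of y x])
    finally have "2 * b' x d / b' d d = 1" using dd by (simp add: field_simps)
    hence "s x = y" by (simp only: s_def d_def) simp
    thus ?thesis using sD[OF x] by simp
  qed simp
qed

section \<open>Uniqueness of the equator\<close>

text \<open>Boundedness comes from the level of \<open>F\<close>, since \<open>b\<close> is an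
  arbitrary bilinear form.\<close>

lemma compact_form_sphere:
  fixes F :: "'a::euclidean_space \<Rightarrow> real" and b :: "'a \<Rightarrow> 'a \<Rightarrow> real"
  assumes F: "norm_like F" and D: "subspace D" and b: "bilinear b"
  shows "compact {w\<in>D. b w w = 1 \<and> F w = r}"
proof -
  obtain c C where c: "c > 0" "\<And>x. c * norm x \<le> F x"
    using norm_like_bounds[OF F] by metis
  have bb: "bounded_bilinear b" using b by (simp add: bilinear_conv_bounded_bilinear)
  have cb: "continuous_on UNIV (\<lambda>w. b w w)"
    by (intro bounded_bilinear.continuous_on[OF bb] continuous_on_id)
  have "{w\<in>D. b w w = 1 \<and> F w = r} = D \<inter> ({w. b w w = 1} \<inter> {w. F w = r})" by auto
  moreover have "closed \<dots>"
    by (intro closed_Int closed_subspace D closed_Collect_eq cb norm_like_continuous_on[OF F]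
        continuous_on_const)
  moreover have "bounded {w\<in>D. b w w = 1 \<and> F w = r}"
  proof (rule boundedI)
    fix w assume "w \<in> {w\<in>D. b w w = 1 \<and> F w = r}"
    thus "norm w \<le> r / c" using c(1) c(2)[of w] by (simp add: field_simps)
  qed
  ultimately show ?thesis by (simp add: compact_eq_bounded_closed)
qed

text \<open>Among the points of the \<open>b\<close>-sphere where \<open>F\<close> has a given value, one that maximises the
  coordinate along the first axis must be the pole of that axis: the first symmetry moves it,
  within its latitude, off the plane spanned by the two axes, and there the second symmetry would
  increase the coordinate.\<close>

lemma two_axes_constant:
  fixes F :: "'a::euclidean_space \<Rightarrow> real"
  assumes F: "norm_like F" and D: "subspace D" and b: "pd_form D b"
    and A1: "A1 \<in> D" "b A1 A1 = 1" and A2: "A2 \<in> D" "b A2 A2 = 1"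
    and e: "e \<in> D" "b e e = 1" "b e A2 = 0" "A1 = c *\<^sub>R A2 + s *\<^sub>R e" "s > 0"
    and z: "z \<in> D" "b z z = 1" "b A1 z = 0" "b A2 z = 0"
    and r1: "\<And>x y. x \<in> D \<Longrightarrow> y \<in> D \<Longrightarrow> b A1 x = b A1 y \<Longrightarrow> b x x = b y y \<Longrightarrow> F x = F y"
    and r2: "\<And>x y. x \<in> D \<Longrightarrow> y \<in> D \<Longrightarrow> b A2 x = b A2 y \<Longrightarrow> b x x = b y y \<Longrightarrow> F x = F y"
    and v: "v \<in> D" "b v v = 1"
  shows "F v = F A1"
proof -
  note bl = pd_formD(1)[OF b] and sym = pd_formD(2)[OF b]
  note bs = bilinear_ladd[OF bl] bilinear_radd[OF bl] bilinear_lsub[OF bl] bilinear_rsub[OF bl]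
    bilinear_lmul[OF bl] bilinear_rmul[OF bl]
  define X where "X = {w\<in>D. b w w = 1 \<and> F w = F v}"
  have "compact X" unfolding X_def by (rule compact_form_sphere[OF F D bl])
  moreover have "v \<in> X" using v by (simp add: X_def)
  moreover have "continuous_on X (\<lambda>w. b A1 w)"
    using bl by (intro linear_continuous_on) (simp add: bilinear_def linear_conv_bounded_linear)
  ultimately obtain w where w: "w \<in> X" and wmax: "\<And>y. y \<in> X \<Longrightarrow> b A1 y \<le> b A1 w"
    using continuous_attains_sup by (metis empty_iff)
  have wD: "w \<in> D" "b w w = 1" "F w = F v" using w by (auto simp: X_def)
  define t where "t = b A1 w"
  have "0 \<le> b (w - t *\<^sub>R A1) (w - t *\<^sub>R A1)"
    by (rule pd_formD(4)[OF b]) (intro subspace_diff subspace_scale D wD A1)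
  also have "\<dots> = 1 - t\<^sup>2" by (simp add: bs A1 wD sym[of w A1] t_def power2_eq_square)
  finally have t1: "t\<^sup>2 \<le> 1" by simp
  have A12: "b A1 A2 = c" "b A2 A1 = c" "b A1 e = s" "b e A1 = s" "b A2 e = 0"
    using sym[of A2 e] e A2 by (simp_all add: bs)
  have cs: "c\<^sup>2 + s\<^sup>2 = 1"
  proof -
    have "b A1 A1 = c * b A1 A2 + s * b A1 e" by (subst (2) e(4)) (simp add: bs)
    thus ?thesis using A12 A1 by (simp add: power2_eq_square)
  qed
  \<comment> \<open>\<open>z\<close> is \<open>b\<close>-orthogonal to both axes, so turning
    \<open>w\<close> about \<open>A1\<close> towards \<open>z\<close> leaves exactly
    \<open>t * c\<close> as the coordinate along \<open>A2\<close>.\<close>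
  define w1 where "w1 = t *\<^sub>R A1 + sqrt (1 - t\<^sup>2) *\<^sub>R z"
  have w1: "w1 \<in> D" unfolding w1_def by (intro subspace_add subspace_scale D A1 z)
  have bw1: "b A1 w1 = t" "b A2 w1 = t * c" by (simp_all add: w1_def bs A1 z A12)
  have bw1': "b w1 w1 = 1"
    using t1 sym[of z A1] by (simp add: w1_def bs A1 z power2_eq_square[symmetric])
  have "F w1 = F w" using r1[OF w1 wD(1)] bw1 bw1' wD by (simp add: t_def)
  hence Fw1: "F w1 = F v" using wD by simp
  define \<alpha> where "\<alpha> = t * c"
  have "\<alpha>\<^sup>2 \<le> 1 * 1" unfolding \<alpha>_def power_mult_distrib
    using t1 cs zero_le_power2[of s] zero_le_power2[of c] by (intro mult_mono; linarith)
  hence \<alpha>1: "\<alpha>\<^sup>2 \<le> 1" by simp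
  \<comment> \<open>Among the \<open>b\<close>-unit vectors with \<open>A2\<close>-coordinate
    \<open>\<alpha>\<close>, this one has the largest \<open>A1\<close>-coordinate, because
    \<open>A1 = c *\<^sub>R A2 + s *\<^sub>R e\<close> with \<open>s > 0\<close>.\<close>
  define w2 where "w2 = \<alpha> *\<^sub>R A2 + sqrt (1 - \<alpha>\<^sup>2) *\<^sub>R e"
  have w2: "w2 \<in> D" unfolding w2_def by (intro subspace_add subspace_scale D A2 e)
  have bw2: "b A2 w2 = \<alpha>" "b A1 w2 = \<alpha> * c + sqrt (1 - \<alpha>\<^sup>2) * s" by (simp_all add: w2_def bs A2 A12)
  have bw2': "b w2 w2 = 1"
    using \<alpha>1 by (simp add: w2_def bs A2 e A12 power2_eq_square[symmetric])
  have "F w2 = F w1" using r2[OF w2 w1] bw1 bw1' bw2 bw2' by (simp add: \<alpha>_def)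
  hence "w2 \<in> X" using w2 bw2' Fw1 by (simp add: X_def)
  \<comment> \<open>Together with \<open>c\<^sup>2 + s\<^sup>2 = 1\<close>, maximality of
    \<open>t\<close> forces \<open>t\<^sup>2 \<ge> 1\<close>, so the maximiser sits at the
    pole.\<close>
  from wmax[OF this] have "\<alpha> * c + sqrt (1 - \<alpha>\<^sup>2) * s \<le> t" by (simp add: bw2 t_def)
  hence "sqrt (1 - \<alpha>\<^sup>2) * s \<le> t * (1 - c\<^sup>2)" by (simp add: \<alpha>_def algebra_simps power2_eq_square)
  also have "1 - c\<^sup>2 = s * s" using cs by (simp add: power2_eq_square)
  finally have le: "sqrt (1 - \<alpha>\<^sup>2) \<le> t * s" using e(5) by (simp add: mult.assoc[symmetric])
  have sq0: "0 \<le> sqrt (1 - \<alpha>\<^sup>2)" using \<alpha>1 by simp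
  have "0 \<le> t * s" using le sq0 by linarith
  hence t0: "0 \<le> t" using e(5) by (simp add: zero_le_mult_iff)
  have "1 - \<alpha>\<^sup>2 \<le> (t * s)\<^sup>2" using power_mono[OF le sq0, of 2] \<alpha>1 by simp
  hence "1 \<le> t\<^sup>2 * (c\<^sup>2 + s\<^sup>2)" by (simp add: \<alpha>_def power_mult_distrib algebra_simps)
  hence "t\<^sup>2 = 1" using cs t1 by simp
  hence "t = 1" using t0 by (simp add: power2_eq_1_iff)
  hence "w1 = A1" by (simp add: w1_def)
  thus ?thesis using Fw1 by simp
qed

text \<open>Both structures are rotational for one invariant form \<open>b\<close>. If the first
  equator were not inside the second, the axes would be independent, and with \<open>z\<close> as
  third direction \<open>two_axes_constant\<close> would make \<open>F\<close> constant on the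
  \<open>b\<close>-sphere, hence Euclidean.\<close>

lemma rotational_equator_unique:
  fixes F :: "real ^ 'm \<Rightarrow> real"
  assumes F: "norm_like F" and D: "subspace D"
    and rot1: "rotational F D e1 b1" and rot2: "rotational F D e2 b2"
    and z: "z \<in> D" "z \<noteq> 0" "e1 \<bullet> z = 0" "e2 \<bullet> z = 0"
    and not: "\<not> parallelogram F D" and x: "x \<in> D" "e1 \<bullet> x = 0"
  shows "e2 \<bullet> x = 0"
proof (rule ccontr)
  assume e2x: "e2 \<bullet> x \<noteq> 0"
  obtain b where b0: "pd_form UNIV b"
    and inv: "\<And>g x y. linear g \<Longrightarrow> (\<And>x. x \<in> D \<Longrightarrow> g x \<in> D \<and> F (g x) = F x) \<Longrightarrow>
      x \<in> D \<Longrightarrow> y \<in> D \<Longrightarrow> b (g x) (g y) = b x y"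
    using ex_invariant_form_on[OF F D] by (metis (no_types, lifting))
  have b: "pd_form D b" using b0 by (simp add: pd_form_def)
  note bl = pd_formD(1)[OF b] and sym = pd_formD(2)[OF b] and pos = pd_formD(3)[OF b]
  note bs = bilinear_ladd[OF bl] bilinear_radd[OF bl] bilinear_lsub[OF bl] bilinear_rsub[OF bl]
    bilinear_lmul[OF bl] bilinear_rmul[OF bl]
  note R1 = rotationalD(2)[OF rotational_invariant_form[OF D rot1 b inv]]
  note R2 = rotationalD(2)[OF rotational_invariant_form[OF D rot2 b inv]]
  obtain a1 where a1: "a1 \<in> D" "\<And>x. x \<in> D \<Longrightarrow> b a1 x = e1 \<bullet> x"
    using pd_form_representer[OF D b] by blast
  obtain a2 where a2: "a2 \<in> D" "\<And>x. x \<in> D \<Longrightarrow> b a2 x = e2 \<bullet> x"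
    using pd_form_representer[OF D b] by blast
  have a1_0: "a1 \<noteq> 0"
  proof
    assume "a1 = 0"
    hence "\<And>x. x \<in> D \<Longrightarrow> e1 \<bullet> x = 0" using a1(2) bilinear_lzero[OF bl] by auto
    hence "quadratic_on F D" by (rule rotational_quadratic_equator[OF F D rot1])
    thus False using quadratic_on_parallelogram D not by blast
  qed
  have a2_0: "a2 \<noteq> 0" using a2(2)[OF x(1)] e2x bilinear_lzero[OF bl] by auto
  define n1 where "n1 = sqrt (b a1 a1)"
  define n2 where "n2 = sqrt (b a2 a2)"
  have n1: "n1 > 0" "n1 * n1 = b a1 a1" using pos[OF a1(1) a1_0] by (simp_all add: n1_def)
  have n2: "n2 > 0" "n2 * n2 = b a2 a2" using pos[OF a2(1) a2_0] by (simp_all add: n2_def)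
  define A1 where "A1 = (1 / n1) *\<^sub>R a1"
  define A2 where "A2 = (1 / n2) *\<^sub>R a2"
  have A1: "A1 \<in> D" "b A1 A1 = 1" "\<And>x. x \<in> D \<Longrightarrow> b A1 x = (e1 \<bullet> x) / n1"
    using n1 a1 D pos[OF a1(1) a1_0] by (simp_all add: A1_def bs subspace_scale flip: n1(2))
  have A2: "A2 \<in> D" "b A2 A2 = 1" "\<And>x. x \<in> D \<Longrightarrow> b A2 x = (e2 \<bullet> x) / n2"
    using n2 a2 D pos[OF a2(1) a2_0] by (simp_all add: A2_def bs subspace_scale flip: n2(2))
  define c where "c = b A1 A2"
  \<comment> \<open>The part of \<open>A1\<close> that is \<open>b\<close>-orthogonal to
    \<open>A2\<close>. It is nonzero because \<open>x\<close> lies on the first equator but not on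
    the second.\<close>
  define e' where "e' = A1 - c *\<^sub>R A2"
  have e': "e' \<in> D" unfolding e'_def by (intro subspace_diff subspace_scale D A1 A2)
  have "e' \<noteq> 0"
  proof
    assume "e' = 0"
    hence "A1 = c *\<^sub>R A2" by (simp add: e'_def)
    hence "b A1 x = c * b A2 x" by (simp add: bs)
    hence "c = 0" using A1(3)[OF x(1)] A2(3)[OF x(1)] x(2) e2x n2(1) by simp
    thus False using \<open>A1 = c *\<^sub>R A2\<close> A1(2) bilinear_lzero[OF bl] by simp
  qed
  hence p: "b e' e' > 0" using pos e' by blast
  define s where "s = sqrt (b e' e')"
  have s: "s > 0" "s * s = b e' e'" using p by (simp_all add: s_def)
  define e where "e = (1 / s) *\<^sub>R e'"
  have e: "e \<in> D" "b e e = 1" "A1 = c *\<^sub>R A2 + s *\<^sub>R e"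
    using e' D s p by (simp_all add: e_def bs subspace_scale e'_def[symmetric] flip: s(2))
      (simp add: e'_def)
  have eA2: "b e A2 = 0" by (simp add: e_def e'_def bs A2(2) c_def)
  define k where "k = sqrt (b z z)"
  have k: "k > 0" "k * k = b z z" using pos[OF z(1,2)] by (simp_all add: k_def)
  define Z where "Z = (1 / k) *\<^sub>R z"
  have Z: "Z \<in> D" "b Z Z = 1" "b A1 Z = 0" "b A2 Z = 0"
    using k z D A1(3)[OF z(1)] A2(3)[OF z(1)] by (simp_all add: Z_def bs subspace_scale flip: k(2))
  have r1: "F x = F y" if "x \<in> D" "y \<in> D" "b A1 x = b A1 y" "b x x = b y y" for x y
    using that n1(1) by (intro R1) (simp_all add: A1(3))
  have r2: "F x = F y" if "x \<in> D" "y \<in> D" "b A2 x = b A2 y" "b x x = b y y" for x y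
    using that n2(1) by (intro R2) (simp_all add: A2(3))
  have const: "F v = F A1" if "v \<in> D" "b v v = 1" for v
    by (rule two_axes_constant[OF F D b A1(1,2) A2(1,2) e(1,2) eA2 e(3) s(1) Z r1 r2 that])
  have "(F v)\<^sup>2 = (F A1)\<^sup>2 * b v v" if v: "v \<in> D" for v
  proof (cases "v = 0")
    case True
    thus ?thesis by (simp add: norm_like_zero[OF F] bilinear_lzero[OF bl])
  next
    case False
    define m where "m = sqrt (b v v)"
    have m: "m > 0" "m * m = b v v" using pos[OF v False] by (simp_all add: m_def)
    have "F ((1 / m) *\<^sub>R v) = F A1"
      using m v D by (intro const) (simp_all add: subspace_scale bs flip: m(2))
    hence "F v = m * F A1" using m(1) by (simp add: norm_like_scale[OF F] field_simps)
    thus ?thesis by (simp add: power_mult_distrib power2_eq_square m(2)[symmetric] mult_ac)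
  qed
  hence "quadratic_on F D" by (rule quadratic_on_of_form[OF bl sym])
  thus False using quadratic_on_parallelogram D not by blast
qed

section \<open>A hyperplane with Euclidean restriction\<close>

lemma ex_orthogonal_nonzero:
  fixes S :: "'a::euclidean_space set"
  assumes "finite S" "card S < DIM('a)"
  shows "\<exists>z. z \<noteq> 0 \<and> (\<forall>s\<in>S. s \<bullet> z = 0)"
proof -
  have "dim S < DIM('a)" using dim_le_card'[OF assms(1)] assms(2) by linarith
  then obtain z where "z \<noteq> 0" "\<And>y. y \<in> span S \<Longrightarrow> orthogonal z y"
    using orthogonal_to_subspace_exists by blast
  thus ?thesis by (metis inner_commute orthogonal_def span_base)
qed

text \<open>In finite dimension the double orthogonal complement of a set is its span.\<close>

lemma in_span_if_orthogonal:
  fixes S :: "'a::euclidean_space set"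
  assumes "\<And>z. (\<And>s. s \<in> S \<Longrightarrow> s \<bullet> z = 0) \<Longrightarrow> e \<bullet> z = 0"
  shows "e \<in> span S"
proof -
  obtain u v where uv: "u \<in> span S" "\<And>w. w \<in> span S \<Longrightarrow> orthogonal v w" "e = u + v"
    using orthogonal_subspace_decomp_exists[of S e] by metis
  have "e \<bullet> v = 0" using uv(2) by (intro assms) (metis inner_commute orthogonal_def span_base)
  moreover have "u \<bullet> v = 0" using uv(1,2) by (metis inner_commute orthogonal_def)
  ultimately have "v = 0" using uv(3) by (simp add: inner_simps)
  thus ?thesis using uv by simp
qed

lemma in_span_pair: "v \<in> span {x, y} \<longleftrightarrow> (\<exists>\<alpha> \<beta>. v = \<alpha> *\<^sub>R x + \<beta> *\<^sub>R y)"
  unfolding span_breakdown_eq span_empty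
  by (metis (no_types, opaque_lifting) add.commute diff_add_cancel eq_iff_diff_eq_0
      add_diff_cancel_left' singletonD singletonI)

lemma in_span_triple: "v \<in> span {x, y, z} \<longleftrightarrow> (\<exists>\<alpha> \<beta> \<gamma>. v = \<alpha> *\<^sub>R x + \<beta> *\<^sub>R y + \<gamma> *\<^sub>R z)"
proof -
  have "v \<in> span {x, y, z} \<longleftrightarrow> (\<exists>\<alpha>. v - \<alpha> *\<^sub>R x \<in> span {y, z})" by (rule span_breakdown_eq)
  also have "\<dots> \<longleftrightarrow> (\<exists>\<alpha> \<beta> \<gamma>. v = \<alpha> *\<^sub>R x + \<beta> *\<^sub>R y + \<gamma> *\<^sub>R z)"
    by (simp only: in_span_pair diff_eq_eq add.commute add.left_commute add.assoc)
  finally show ?thesis .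
qed

text \<open>Two independent vectors of a plane generate it, by Cramer's rule with determinant
  \<open>a * d - b * c\<close>.\<close>

lemma in_span_of_two_in_span_pair:
  assumes "p \<in> span {y, e}" "v \<in> span {y, e}" "p \<noteq> 0" "\<And>k. v \<noteq> k *\<^sub>R p"
  shows "y \<in> span {p, v}"
proof -
  obtain a b where p: "p = a *\<^sub>R y + b *\<^sub>R e" using assms(1) in_span_pair by blast
  obtain c d where v: "v = c *\<^sub>R y + d *\<^sub>R e" using assms(2) in_span_pair by blast
  have ne: "a * d - b * c \<noteq> 0"
  proof
    assume z: "a * d - b * c = 0"
    show False
    proof (cases "a = 0")
      case True
      hence "b \<noteq> 0" "c = 0" using p assms(3) z by auto
      hence "v = (d / b) *\<^sub>R p" using True by (simp add: p v)
      thus False using assms(4) by blast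
    next
      case False
      hence "d = b * c / a" using z by (simp add: field_simps)
      hence "v = (c / a) *\<^sub>R p" using False by (simp add: p v scaleR_add_right mult.commute)
      thus False using assms(4) by blast
    qed
  qed
  have "d *\<^sub>R p - b *\<^sub>R v = (a * d - b * c) *\<^sub>R y" by (simp add: p v algebra_simps)
  hence "y = (1 / (a * d - b * c)) *\<^sub>R (d *\<^sub>R p - b *\<^sub>R v)" using ne by simp
  moreover have "d *\<^sub>R p - b *\<^sub>R v \<in> span {p, v}" by (intro span_diff span_scale span_base) auto
  ultimately show ?thesis using span_scale by metis
qed

lemma rotational_subset:
  "rotational F D e b \<Longrightarrow> D' \<subseteq> D \<Longrightarrow> rotational F D' e b"
  unfolding rotational_def pd_form_def by blast

text \<open>Violating the law is an open condition: a violating pair is pushed into the tilted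
  hyperplane and tends to the original pair as \<open>\<epsilon>\<close> tends to 0.\<close>

lemma parallelogram_perturb:
  fixes F :: "'a::euclidean_space \<Rightarrow> real"
  assumes F: "norm_like F" and w: "w \<noteq> 0" "x \<bullet> w = 0" and z: "z \<bullet> w \<ge> 0"
    and not: "\<not> parallelogram F ({y. x \<bullet> y = 0} \<inter> {y. w \<bullet> y = 0})"
  shows "eventually (\<lambda>\<epsilon>. \<not> parallelogram F ({y. x \<bullet> y = 0} \<inter> {y. (w + \<epsilon> *\<^sub>R z) \<bullet> y = 0})) (at_right 0)"
proof -
  obtain u v where uv: "x \<bullet> u = 0" "w \<bullet> u = 0" "x \<bullet> v = 0" "w \<bullet> v = 0"
    and ne: "(F (u + v))\<^sup>2 + (F (u - v))\<^sup>2 \<noteq> 2 * (F u)\<^sup>2 + 2 * (F v)\<^sup>2"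
    using not unfolding parallelogram_def by blast
  \<comment> \<open>Projection along \<open>w\<close> onto the tilted hyperplane. It keeps
    \<open>x \<bullet> y\<close> because \<open>x \<bullet> w = 0\<close>, and
    \<open>z \<bullet> w \<ge> 0\<close> keeps the denominator positive for
    \<open>\<epsilon> > 0\<close>.\<close>
  define \<pi> where "\<pi> y \<epsilon> = y - (((w + \<epsilon> *\<^sub>R z) \<bullet> y) / ((w + \<epsilon> *\<^sub>R z) \<bullet> w)) *\<^sub>R w" for y and \<epsilon> :: real
  have lim: "((\<pi> y) \<longlongrightarrow> y) (at_right 0)" if "w \<bullet> y = 0" for y
    unfolding \<pi>_def using w(1) by (auto intro!: tendsto_eq_intros simp: that)
  have Flim: "((\<lambda>\<epsilon>. F (g \<epsilon>)) \<longlongrightarrow> F l) (at_right 0)" if "(g \<longlongrightarrow> l) (at_right 0)" for g l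
    using continuous_on_tendsto_compose[OF norm_like_continuous_on[OF F, of UNIV] that] by simp
  define f where "f \<epsilon> = (F (\<pi> u \<epsilon> + \<pi> v \<epsilon>))\<^sup>2 + (F (\<pi> u \<epsilon> - \<pi> v \<epsilon>))\<^sup>2
      - (2 * (F (\<pi> u \<epsilon>))\<^sup>2 + 2 * (F (\<pi> v \<epsilon>))\<^sup>2)" for \<epsilon>
  have "(f \<longlongrightarrow> (F (u + v))\<^sup>2 + (F (u - v))\<^sup>2 - (2 * (F u)\<^sup>2 + 2 * (F v)\<^sup>2)) (at_right 0)"
    unfolding f_def by (intro tendsto_intros Flim lim uv)
  hence "eventually (\<lambda>\<epsilon>. f \<epsilon> \<noteq> 0) (at_right 0)"
    by (rule tendsto_imp_eventually_ne) (use ne in simp)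
  moreover have "eventually (\<lambda>\<epsilon>::real. \<epsilon> > 0) (at_right 0)" by (rule eventually_at_right_less)
  ultimately show ?thesis
  proof eventually_elim
    case (elim \<epsilon>)
    have "(w + \<epsilon> *\<^sub>R z) \<bullet> w > 0" using w(1) z elim(2) by (simp add: inner_simps add_pos_nonneg)
    hence "x \<bullet> \<pi> y \<epsilon> = 0 \<and> (w + \<epsilon> *\<^sub>R z) \<bullet> \<pi> y \<epsilon> = 0" if "x \<bullet> y = 0" for y
      using that w(2) by (simp add: \<pi>_def inner_diff_right)
    thus ?case using elim(1) uv unfolding parallelogram_def f_def by fastforce
  qed
qed

lemma ex_parallelogram_hyperplane:
  fixes F :: "real ^ 'm \<Rightarrow> real"
  assumes F: "norm_like F" and m: "CARD('m) \<ge> 5"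
    and rot: "\<And>x. x \<noteq> 0 \<Longrightarrow> \<exists>e b. rotational F {y. x \<bullet> y = 0} e b"
  shows "\<exists>x. x \<noteq> 0 \<and> parallelogram F {y. x \<bullet> y = 0}"
proof (rule ccontr)
  define H where "H x = {y. x \<bullet> y = 0}" for x :: "real ^ 'm"
  assume "\<not> (\<exists>x. x \<noteq> 0 \<and> parallelogram F {y. x \<bullet> y = 0})"
  hence np: "\<not> parallelogram F (H x)" if "x \<noteq> 0" for x using that by (auto simp: H_def)
  obtain e b where eb: "\<And>x. x \<noteq> 0 \<Longrightarrow> rotational F (H x) (e x) (b x)"
    using rot unfolding H_def by metis
  have sub: "subspace (H x)" for x unfolding H_def by (rule subspace_hyperplane)
  \<comment> \<open>The dimension bound enters here: in dimension at least 5, four linear conditions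
    leave a nonzero solution.\<close>
  have orth: "\<exists>z::real^'m. z \<noteq> 0 \<and> (\<forall>s\<in>S. s \<bullet> z = 0)" if "finite S" "card S \<le> 4" for S
    using that m by (intro ex_orthogonal_nonzero) auto
  have card4: "card {p, q, r, s} \<le> 4" "card {p, q, r} \<le> 4" "card {p, q} \<le> 4" for p q r s :: "real^'m"
    by (simp_all add: card_insert_if)
  define P where "P x = span {x, e x}" for x

  \<comment> \<open>So \<open>P x\<close> is a genuine plane: a multiple of \<open>x\<close>
    vanishes on \<open>H x\<close>, which would make the restriction Euclidean.\<close>
  have e_ne: "e x \<noteq> c *\<^sub>R x" if x: "x \<noteq> 0" for x c
  proof
    assume "e x = c *\<^sub>R x"
    hence "\<And>y. y \<in> H x \<Longrightarrow> e x \<bullet> y = 0" by (simp add: H_def)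
    from rotational_quadratic_equator[OF F sub eb[OF x] this] np[OF x] sub quadratic_on_parallelogram
    show False by blast
  qed

  \<comment> \<open>On \<open>H x \<inter> H w\<close> both structures apply, and \<open>z\<close>
    lies on both equators. Uniqueness of the equator then places \<open>e w\<close> in the double
    complement of \<open>{x, w, e x}\<close>.\<close>
  have rel: "\<exists>\<alpha> \<beta> \<gamma>. e w = \<alpha> *\<^sub>R x + \<beta> *\<^sub>R w + \<gamma> *\<^sub>R e x"
    if x: "x \<noteq> 0" and w: "w \<noteq> 0" and n: "\<not> parallelogram F (H x \<inter> H w)" for x w
  proof -
    obtain z where z: "z \<noteq> 0" "\<forall>s\<in>{x, w, e x, e w}. s \<bullet> z = 0"
      using orth[of "{x, w, e x, e w}"] card4 by blast
    have "e w \<in> span {x, w, e x}"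
    proof (rule in_span_if_orthogonal)
      fix y assume y: "\<And>s. s \<in> {x, w, e x} \<Longrightarrow> s \<bullet> y = 0"
      show "e w \<bullet> y = 0"
        by (rule rotational_equator_unique[OF F subspace_inter[OF sub sub]
            rotational_subset[OF eb[OF x] Int_lower1] rotational_subset[OF eb[OF w] Int_lower2]
            _ z(1) _ _ n])
          (use z(2) y in \<open>auto simp: H_def\<close>)
    qed
    thus ?thesis by (simp add: in_span_triple)
  qed

  \<comment> \<open>\<open>a\<close> is the axis of \<open>H x\<close>. A section orthogonal to
    \<open>w\<close> that contains it also contains an equatorial direction, so if it were
    Euclidean, all of \<open>H x\<close> would be.\<close>
  have "\<exists>a\<in>H x. a \<noteq> 0 \<and> (\<forall>w. w \<bullet> a = 0 \<longrightarrow> \<not> parallelogram F (H x \<inter> H w))" if x: "x \<noteq> 0" for x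
  proof -
    obtain a where a: "a \<in> H x" "\<And>y. y \<in> H x \<Longrightarrow> b x a y = e x \<bullet> y"
      using pd_form_representer[OF sub rotationalD(1)[OF eb[OF x]]] by blast
    have a0: "a \<noteq> 0"
    proof
      assume "a = 0"
      hence "\<And>y. y \<in> H x \<Longrightarrow> e x \<bullet> y = 0"
        using a(2) bilinear_lzero[OF pd_formD(1)[OF rotationalD(1)[OF eb[OF x]]]] by metis
      from rotational_quadratic_equator[OF F sub eb[OF x] this] np[OF x] sub quadratic_on_parallelogram
      show False by blast
    qed
    have "\<not> parallelogram F (H x \<inter> H w)" if w: "w \<bullet> a = 0" for w
    proof
      assume par: "parallelogram F (H x \<inter> H w)"
      obtain u where u: "u \<noteq> 0" "\<forall>s\<in>{x, w, e x}. s \<bullet> u = 0"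
        using orth[of "{x, w, e x}"] card4 by blast
      have "quadratic_on F (H x)"
        by (rule rotational_quadratic_section[OF F sub eb[OF x] a(1) a0 a(2)
            subspace_inter[OF sub sub] Int_lower1 _ _ u(1) _ par])
          (use a(1) w u(2) in \<open>auto simp: H_def\<close>)
      thus False using np[OF x] sub quadratic_on_parallelogram by blast
    qed
    thus ?thesis using a(1) a0 by blast
  qed
  then obtain a where a: "\<And>x w. x \<noteq> 0 \<Longrightarrow> w \<bullet> a x = 0 \<Longrightarrow> \<not> parallelogram F (H x \<inter> H w)"
    by metis

  have meet: "\<exists>v. v \<noteq> 0 \<and> v \<in> P x \<and> v \<in> P y" if x: "x \<noteq> 0" and y: "y \<noteq> 0" for x y
  proof -
    \<comment> \<open>Orthogonality to \<open>a x\<close> and \<open>a y\<close> makes both sections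
      non-Euclidean; orthogonality to \<open>x\<close> and \<open>y\<close> is what the perturbation
      lemma requires. Tilting \<open>w0\<close> towards \<open>z\<close> then moves it out of
      \<open>P x + P y\<close> while the sections stay non-Euclidean.\<close>
    obtain w0 where w0: "w0 \<noteq> 0" "\<forall>s\<in>{a x, a y, x, y}. s \<bullet> w0 = 0"
      using orth[of "{a x, a y, x, y}"] card4 by blast
    obtain z0 where z0: "z0 \<noteq> 0" "\<forall>s\<in>{x, e x, y, e y}. s \<bullet> z0 = 0"
      using orth[of "{x, e x, y, e y}"] card4 by blast
    define z where "z = (if z0 \<bullet> w0 \<ge> 0 then z0 else - z0)"
    have z: "z \<noteq> 0" "z \<bullet> x = 0" "z \<bullet> e x = 0" "z \<bullet> y = 0" "z \<bullet> e y = 0" "z \<bullet> w0 \<ge> 0"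
      using z0 by (auto simp: z_def inner_commute)
    have "eventually (\<lambda>\<epsilon>. \<not> parallelogram F (H x \<inter> H (w0 + \<epsilon> *\<^sub>R z))
        \<and> \<not> parallelogram F (H y \<inter> H (w0 + \<epsilon> *\<^sub>R z)) \<and> \<epsilon> > 0) (at_right 0)"
      unfolding H_def
      by (intro eventually_conj parallelogram_perturb[OF F w0(1) _ z(6)] eventually_at_right_less)
        (use w0(2) a[OF x, of w0] a[OF y, of w0] in \<open>auto simp: H_def inner_commute\<close>)
    then obtain \<epsilon> where \<epsilon>: "\<not> parallelogram F (H x \<inter> H (w0 + \<epsilon> *\<^sub>R z))"
        "\<not> parallelogram F (H y \<inter> H (w0 + \<epsilon> *\<^sub>R z))" "\<epsilon> > 0"
      using eventually_happens'[OF trivial_limit_at_right_real] by blast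
    define w where "w = w0 + \<epsilon> *\<^sub>R z"
    have zw: "z \<bullet> w > 0" using z(1,6) \<epsilon>(3) by (simp add: w_def inner_simps add_nonneg_pos)
    hence w: "w \<noteq> 0" by auto
    obtain \<alpha> \<beta> \<gamma> where 1: "e w = \<alpha> *\<^sub>R x + \<beta> *\<^sub>R w + \<gamma> *\<^sub>R e x"
      using rel[OF x w] \<epsilon>(1) w_def by blast
    obtain \<alpha>' \<beta>' \<gamma>' where 2: "e w = \<alpha>' *\<^sub>R y + \<beta>' *\<^sub>R w + \<gamma>' *\<^sub>R e y"
      using rel[OF y w] \<epsilon>(2) w_def by blast
    \<comment> \<open>Pairing with \<open>z\<close>, which is orthogonal to both planes, shows that
      \<open>w\<close> has the same coefficient in both expansions. Removing this term from
      \<open>e w\<close> leaves a common nonzero vector of \<open>P x\<close> and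
      \<open>P y\<close>.\<close>
    have "z \<bullet> e w = \<beta> * (z \<bullet> w)" "z \<bullet> e w = \<beta>' * (z \<bullet> w)"
      by (simp add: 1 inner_simps z) (simp add: 2 inner_simps z)
    hence \<beta>: "\<beta>' = \<beta>" using zw by simp
    define v where "v = e w - \<beta> *\<^sub>R w"
    have "v \<noteq> 0" using e_ne[OF w, of \<beta>] by (simp add: v_def)
    moreover have "v = \<alpha> *\<^sub>R x + \<gamma> *\<^sub>R e x" using 1 by (simp add: v_def)
    moreover have "v = \<alpha>' *\<^sub>R y + \<gamma>' *\<^sub>R e y" using 2 \<beta> by (simp add: v_def)
    ultimately show ?thesis unfolding P_def in_span_pair by blast
  qed

  obtain x :: "real^'m" where x: "x \<noteq> 0" using vector_choose_size[of 1] by force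
  \<comment> \<open>Orthogonality to \<open>P x\<close> puts \<open>y\<close> outside it, so
    \<open>P x\<close> and \<open>P y\<close> are different planes and share a single line.\<close>
  obtain y where y: "y \<noteq> 0" "\<forall>s\<in>{x, e x}. s \<bullet> y = 0" using orth[of "{x, e x}"] card4 by blast
  have yP: "y \<notin> P x"
  proof
    assume "y \<in> P x"
    then obtain \<alpha> \<beta> where "y = \<alpha> *\<^sub>R x + \<beta> *\<^sub>R e x" unfolding P_def in_span_pair by blast
    from arg_cong[OF this, of "\<lambda>v. v \<bullet> y"] show False using y by (simp add: inner_simps)
  qed
  obtain p where p: "p \<noteq> 0" "p \<in> P x" "p \<in> P y" using meet[OF x y(1)] by blast
  obtain q where q: "q \<noteq> 0" "\<forall>s\<in>{x, e x, y, e y}. s \<bullet> q = 0"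
    using orth[of "{x, e x, y, e y}"] card4 by blast
  have qP: "q \<bullet> v = 0" if "v \<in> P x \<or> v \<in> P y" for v
    using that q(2) unfolding P_def in_span_pair by (auto simp: inner_simps inner_commute)
  \<comment> \<open>\<open>P w\<close> meets \<open>P x\<close> and \<open>P y\<close>. Independent
    meeting vectors would span \<open>P w\<close>, giving \<open>q \<bullet> w = 0\<close>; so they
    lie on one line, common to \<open>P x\<close> and \<open>P y\<close>, and that is the line of
    \<open>p\<close>.\<close>
  have pgen: "p \<in> P w" if w: "q \<bullet> w \<noteq> 0" for w
  proof -
    have w0: "w \<noteq> 0" using w by auto
    obtain v1 where v1: "v1 \<noteq> 0" "v1 \<in> P x" "v1 \<in> P w" using meet[OF x w0] by blast
    obtain v2 where v2: "v2 \<noteq> 0" "v2 \<in> P y" "v2 \<in> P w" using meet[OF y(1) w0] by blast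
    have "\<exists>k. v2 = k *\<^sub>R v1"
    proof (rule ccontr)
      assume "\<not> (\<exists>k. v2 = k *\<^sub>R v1)"
      hence "w \<in> span {v1, v2}"
        using in_span_of_two_in_span_pair[of v1 w "e w" v2] v1 v2 unfolding P_def by blast
      then obtain \<alpha> \<beta> where "w = \<alpha> *\<^sub>R v1 + \<beta> *\<^sub>R v2" unfolding in_span_pair by blast
      thus False using w qP v1(2) v2(2) by (simp add: inner_simps)
    qed
    then obtain k where k: "v2 = k *\<^sub>R v1" by blast
    have v1y: "v1 \<in> P y"
    proof -
      have "k \<noteq> 0" using k v2(1) by auto
      hence "v1 = (1 / k) *\<^sub>R v2" using k by simp
      thus ?thesis using v2(2) span_scale unfolding P_def by blast
    qed
    have "\<exists>k. p = k *\<^sub>R v1"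
    proof (rule ccontr)
      assume "\<not> (\<exists>k. p = k *\<^sub>R v1)"
      hence "y \<in> span {v1, p}"
        using in_span_of_two_in_span_pair[of v1 y "e y" p] v1 v1y p unfolding P_def by blast
      moreover have "span {v1, p} \<subseteq> P x"
        using v1(2) p(2) unfolding P_def by (intro span_minimal) auto
      ultimately show False using yP by blast
    qed
    thus ?thesis using v1(3) span_scale unfolding P_def by blast
  qed
  have pall: "p \<in> P z" if z: "z \<noteq> 0" for z
  proof (rule ccontr)
    assume pz: "p \<notin> P z"
    obtain r where r: "r \<noteq> 0" "\<forall>s\<in>{p, z, e z}. s \<bullet> r = 0" using orth[of "{p, z, e z}"] card4 by blast
    \<comment> \<open>Chosen so that both \<open>q \<bullet> w\<close> and
      \<open>r \<bullet> w\<close> are nonzero. Then \<open>P w\<close> contains \<open>p\<close>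
      and also a vector of \<open>P z\<close> independent of \<open>p\<close>; these span
      \<open>w\<close> and are orthogonal to \<open>r\<close>, a contradiction.\<close>
    define w where "w = (if q \<bullet> r = 0 then q + r else q)"
    have w: "q \<bullet> w \<noteq> 0" "r \<bullet> w \<noteq> 0"
      using q(1) r(1) by (auto simp: w_def inner_simps inner_commute)
    have w0: "w \<noteq> 0" using w by auto
    obtain v where v: "v \<noteq> 0" "v \<in> P w" "v \<in> P z" using meet[OF w0 z] by blast
    have "v \<noteq> k *\<^sub>R p" for k
    proof
      assume k: "v = k *\<^sub>R p"
      hence "k \<noteq> 0" using v(1) by auto
      hence "p = (1 / k) *\<^sub>R v" using k by simp
      thus False using pz v(3) span_scale unfolding P_def by blast
    qed
    hence "w \<in> span {p, v}"
      using in_span_of_two_in_span_pair[of p w "e w" v] pgen[OF w(1)] p(1) v(2) unfolding P_def by blast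
    then obtain \<alpha> \<beta> where "w = \<alpha> *\<^sub>R p + \<beta> *\<^sub>R v" unfolding in_span_pair by blast
    moreover have "r \<bullet> v = 0"
      using v(3) r(2) unfolding P_def in_span_pair by (auto simp: inner_simps inner_commute)
    ultimately show False using w(2) r(2) by (simp add: inner_simps inner_commute)
  qed
  have "parallelogram F (H p)"
    unfolding parallelogram_def
  proof (intro ballI)
    fix u v assume uv: "u \<in> H p" "v \<in> H p"
    \<comment> \<open>Since \<open>p\<close> lies in \<open>P z\<close> but is orthogonal to
      \<open>z\<close>, the vector \<open>e z\<close> is a combination of \<open>p\<close> and
      \<open>z\<close>. Hence \<open>u\<close> and \<open>v\<close> lie on the equator of
      \<open>H z\<close>, where \<open>F\<close> is Euclidean.\<close>
    obtain z where z: "z \<noteq> 0" "\<forall>s\<in>{u, v, p}. s \<bullet> z = 0" using orth[of "{u, v, p}"] card4 by blast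
    obtain \<alpha> \<beta> where pz: "p = \<alpha> *\<^sub>R z + \<beta> *\<^sub>R e z"
      using pall[OF z(1)] unfolding P_def in_span_pair by blast
    have \<beta>: "\<beta> \<noteq> 0"
    proof
      assume "\<beta> = 0"
      hence "p \<bullet> z = \<alpha> * (z \<bullet> z)" using pz by simp
      hence "\<alpha> = 0" using z by simp
      thus False using pz \<open>\<beta> = 0\<close> p(1) by simp
    qed
    define D where "D = H z \<inter> H (e z)"
    have "\<beta> * (e z \<bullet> t) = 0" if "t \<in> {u, v}" for t
    proof -
      have "p \<bullet> t = 0" "z \<bullet> t = 0" using that uv z(2) by (auto simp: H_def inner_commute)
      thus ?thesis by (subst (asm) pz) (simp add: inner_simps)
    qed
    hence "u \<in> D" "v \<in> D" using \<beta> z(2) by (auto simp: D_def H_def inner_commute)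
    moreover have sD: "subspace D" unfolding D_def by (rule subspace_inter[OF sub sub])
    moreover have "quadratic_on F D"
      using rotational_subset[OF eb[OF z(1)], of D]
      by (intro rotational_quadratic_equator[OF F sD]) (auto simp: D_def H_def)
    ultimately show "(F (u + v))\<^sup>2 + (F (u - v))\<^sup>2 = 2 * (F u)\<^sup>2 + 2 * (F v)\<^sup>2"
      using quadratic_on_parallelogram unfolding parallelogram_def by blast
  qed
  thus False using np p(1) by blast
qed

section \<open>Support functions\<close>

definition support_function :: "'a::euclidean_space set \<Rightarrow> 'a \<Rightarrow> real" where
  "support_function B y = (SUP b\<in>B. b \<bullet> y)"

lemma bdd_above_inner_image:
  fixes B :: "'a::euclidean_space set"
  assumes "compact B"
  shows "bdd_above ((\<lambda>b. b \<bullet> y) ` B)"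
  by (intro bounded_imp_bdd_above compact_imp_bounded compact_continuous_image continuous_intros assms)

lemma support_function_upper: "compact B \<Longrightarrow> b \<in> B \<Longrightarrow> b \<bullet> y \<le> support_function B y"
  unfolding support_function_def by (rule cSUP_upper[OF _ bdd_above_inner_image])

lemma support_function_least:
  "B \<noteq> {} \<Longrightarrow> (\<And>b. b \<in> B \<Longrightarrow> b \<bullet> y \<le> c) \<Longrightarrow> support_function B y \<le> c"
  unfolding support_function_def by (rule cSUP_least)

text \<open>Boundedness of \<open>B\<close> gives a Lipschitz estimate, symmetry the homogeneity for
  negative factors, and an interior ball positivity.\<close>

lemma norm_like_support_function:
  fixes B :: "'a::euclidean_space set"
  assumes "symmetric_convex_body B"
  shows "norm_like (support_function B)"
proof -
  let ?F = "support_function B"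
  have comp: "compact B" and int: "interior B \<noteq> {}" and sym: "\<And>b. b \<in> B \<Longrightarrow> - b \<in> B"
    using assms by (auto simp: symmetric_convex_body_def convex_body_def)
  have ne: "B \<noteq> {}" using int interior_subset by blast
  note up = support_function_upper[OF comp] and least = support_function_least[OF ne]
  obtain R where R: "R > 0" "\<And>b. b \<in> B \<Longrightarrow> norm b \<le> R"
    using compact_imp_bounded[OF comp] by (auto simp: bounded_pos)
  have lip: "?F y \<le> ?F y' + R * norm (y - y')" for y y'
  proof (rule least)
    fix b assume b: "b \<in> B"
    have "b \<bullet> (y - y') \<le> norm b * norm (y - y')" by (rule norm_cauchy_schwarz)
    also have "\<dots> \<le> R * norm (y - y')" using R(2)[OF b] by (simp add: mult_right_mono)
    finally show "b \<bullet> y \<le> ?F y' + R * norm (y - y')" using up[OF b, of y'] by (simp add: inner_simps)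
  qed
  have "\<bar>?F y - ?F y'\<bar> \<le> R * norm (y - y')" for y y'
    using lip[of y y'] lip[of y' y] by (simp add: norm_minus_commute abs_le_iff)
  hence "R-lipschitz_on UNIV ?F"
    using R(1) by (intro lipschitz_onI) (auto simp: dist_norm)
  hence cont: "continuous_on UNIV ?F" by (rule lipschitz_on_continuous_on)
  have scale_le: "?F (c *\<^sub>R y) \<le> \<bar>c\<bar> * ?F y" for c y
  proof (rule least)
    fix b assume b: "b \<in> B"
    have "\<bar>b \<bullet> y\<bar> \<le> ?F y" using up[OF b, of y] up[OF sym[OF b], of y] by (simp add: abs_le_iff)
    hence "\<bar>c * (b \<bullet> y)\<bar> \<le> \<bar>c\<bar> * ?F y" by (simp add: abs_mult mult_left_mono)
    thus "b \<bullet> c *\<^sub>R y \<le> \<bar>c\<bar> * ?F y" by simp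
  qed
  have scale: "?F (c *\<^sub>R y) = \<bar>c\<bar> * ?F y" for c y
  proof (cases "c = 0")
    case True
    obtain b where "b \<in> B" using ne by blast
    thus ?thesis using True scale_le[of 0 y] up[of b 0] by simp
  next
    case False
    have "?F y \<le> \<bar>1 / c\<bar> * ?F (c *\<^sub>R y)" using scale_le[of "1 / c" "c *\<^sub>R y"] False by simp
    hence "\<bar>c\<bar> * ?F y \<le> ?F (c *\<^sub>R y)" using False by (simp add: field_simps)
    thus ?thesis using scale_le[of c y] by simp
  qed
  have pos: "?F y > 0" if y: "y \<noteq> 0" for y
  proof -
    \<comment> \<open>The centre \<open>b\<close> need not be 0; adding the estimates at a boundary
      point of the ball and at \<open>- b\<close> cancels it.\<close>
    obtain b r where b: "r > 0" "cball b r \<subseteq> B" using int mem_interior_cball by blast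
    have "b + (r / norm y) *\<^sub>R y \<in> B" using b y by (intro subsetD[OF b(2)]) (simp add: dist_norm)
    from up[OF this, of y] have "b \<bullet> y + r * norm y \<le> ?F y"
      using y by (simp add: inner_simps power2_norm_eq_inner[symmetric] power2_eq_square)
    moreover have "- b \<in> B" using b by (intro sym subsetD[OF b(2)]) simp
    from up[OF this, of y] have "- (b \<bullet> y) \<le> ?F y" by simp
    moreover have "r * norm y > 0" using b y by simp
    ultimately show ?thesis by linarith
  qed
  show ?thesis unfolding norm_like_def using cont pos scale by blast
qed

text \<open>The reflection in \<open>v - v'\<close> exchanges \<open>v\<close> and \<open>v'\<close>
  and preserves norms and \<open>a\<close>-coordinates, hence maps \<open>K\<close> into
  itself.\<close>

lemma support_function_rotational:
  fixes K :: "'a::euclidean_space set"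
  assumes comp: "compact K" and ne: "K \<noteq> {}"
    and rot: "\<And>x x'. x \<in> K \<Longrightarrow> a \<bullet> x' = a \<bullet> x \<Longrightarrow> norm x' = norm x \<Longrightarrow> x' \<in> K"
    and v: "a \<bullet> v = a \<bullet> v'" "norm v = norm v'"
  shows "support_function K v = support_function K v'"
proof -
  have le: "support_function K v' \<le> support_function K v"
    if v: "a \<bullet> v = a \<bullet> v'" "v \<bullet> v = v' \<bullet> v'" for v v'
  proof (cases "v = v'")
    case False
    define d where "d = v - v'"
    have d: "d \<bullet> d \<noteq> 0" using False by (simp add: d_def)
    have ad: "a \<bullet> d = 0" using v by (simp add: d_def inner_simps)
    have vd: "2 * (v \<bullet> d) = d \<bullet> d" using v by (simp add: d_def inner_simps inner_commute)
    show ?thesis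
    proof (rule support_function_least[OF ne])
      fix x assume x: "x \<in> K"
      define y where "y = x - (2 * (x \<bullet> d) / (d \<bullet> d)) *\<^sub>R d"
      have "y \<bullet> y = x \<bullet> x" using d by (simp add: y_def inner_simps inner_commute[of d x])
      hence "y \<in> K" using ad by (intro rot[OF x]) (simp_all add: y_def inner_simps norm_eq_sqrt_inner)
      moreover have "y \<bullet> v = x \<bullet> v'"
      proof -
        have "y \<bullet> v = x \<bullet> v - (x \<bullet> d) * (2 * (v \<bullet> d) / (d \<bullet> d))"
          by (simp add: y_def inner_simps inner_commute[of d v])
        also have "\<dots> = x \<bullet> v - x \<bullet> d" using vd d by simp
        finally show ?thesis by (simp add: d_def inner_simps)
      qed
      ultimately show "x \<bullet> v' \<le> support_function K v" using support_function_upper[OF comp, of y v] by simp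
    qed
  qed simp
  show ?thesis
    using le[of v v'] le[of v' v] v by (metis antisym power2_norm_eq_inner)
qed

text \<open>Central symmetry forces the axis through the origin: the section through 0 orthogonal to
  it is a symmetric ball, so its centre, a point of the axis, is 0.\<close>

lemma symmetric_body_of_revolution:
  fixes K :: "'a::euclidean_space set"
  assumes K: "body_of_revolution K" and sym: "uminus ` K = K"
  shows "\<exists>a. \<forall>x\<in>K. \<forall>x'. a \<bullet> x' = a \<bullet> x \<and> norm x' = norm x \<longrightarrow> x' \<in> K"
proof -
  obtain L where L: "affine L" "aff_dim L = 1" and
    ax: "\<And>D. affine_hyperplane D \<Longrightarrow> affine_orthogonal D L \<Longrightarrow>
        \<exists>p r. D \<inter> L = {p} \<and> K \<inter> D = cball p r \<inter> D"
    and cv: "convex K" "interior K \<noteq> {}"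
    using K unfolding body_of_revolution_def axis_of_revolution_def line_def convex_body_def by blast
  obtain S where S: "\<not> affine_dependent S" "affine hull S = L"
    using affine_basis_exists[of L] L(1) by (metis affine_hull_eq)
  have "card S = 2" using aff_dim_affine_independent[OF S(1)] aff_dim_affine_hull[of S] S(2) L(2) by simp
  then obtain p q where pq: "S = {p, q}" "p \<noteq> q" by (auto simp: card_2_iff)
  define a where "a = q - p"
  have a: "a \<noteq> 0" using pq by (simp add: a_def)
  have Lp: "\<exists>t. x = p + t *\<^sub>R a" if x: "x \<in> L" for x
  proof -
    obtain u v where "x = u *\<^sub>R p + v *\<^sub>R q" "u + v = 1"
      using x S(2) unfolding pq(1) affine_hull_2 by blast
    hence "x = p + v *\<^sub>R a" by (simp add: a_def algebra_simps flip: scaleR_add_left)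
    thus ?thesis by blast
  qed
  have sec: "\<exists>p r. {y. a \<bullet> y = s} \<inter> L = {p} \<and> K \<inter> {y. a \<bullet> y = s} = cball p r \<inter> {y. a \<bullet> y = s}" for s
  proof (rule ax)
    have "DIM('a) \<ge> 1" by (simp add: Suc_leI)
    hence "hyperplane {y. a \<bullet> y = 0}"
      using dim_hyperplane[OF a] by (simp add: hyperplane_def subspace_hyperplane)
    moreover have "{y. a \<bullet> y = s} = (+) ((s / (a \<bullet> a)) *\<^sub>R a) ` {y. a \<bullet> y = 0}"
    proof (intro set_eqI iffI)
      fix y assume "y \<in> {y. a \<bullet> y = s}"
      hence "y - (s / (a \<bullet> a)) *\<^sub>R a \<in> {y. a \<bullet> y = 0}" using a by (simp add: inner_simps)
      thus "y \<in> (+) ((s / (a \<bullet> a)) *\<^sub>R a) ` {y. a \<bullet> y = 0}" by (rule rev_image_eqI) simp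
    qed (use a in \<open>auto simp: inner_simps\<close>)
    ultimately show "affine_hyperplane {y. a \<bullet> y = s}" unfolding affine_hyperplane_def by blast
    show "affine_orthogonal {y. a \<bullet> y = s} L"
      unfolding affine_orthogonal_def
    proof (intro ballI)
      fix u v x y assume "u \<in> {y. a \<bullet> y = s}" "v \<in> {y. a \<bullet> y = s}" and xy: "x \<in> L" "y \<in> L"
      hence uv: "(u - v) \<bullet> a = 0" by (simp add: inner_simps inner_commute)
      obtain t1 t2 where "x = p + t1 *\<^sub>R a" "y = p + t2 *\<^sub>R a" using Lp xy by blast
      hence "x - y = (t1 - t2) *\<^sub>R a" by (simp add: algebra_simps)
      thus "orthogonal (u - v) (x - y)" using uv by (simp add: orthogonal_def)
    qed
  qed
  obtain c r where c: "{y. a \<bullet> y = 0} \<inter> L = {c}"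
    "K \<inter> {y. a \<bullet> y = 0} = cball c r \<inter> {y. a \<bullet> y = 0}" using sec by blast
  have mem: "y \<in> K \<longleftrightarrow> dist c y \<le> r" if "a \<bullet> y = 0" for y
  proof -
    have "y \<in> K \<inter> {y. a \<bullet> y = 0} \<longleftrightarrow> y \<in> cball c r \<inter> {y. a \<bullet> y = 0}" by (simp only: c(2))
    thus ?thesis using that by simp
  qed
  have symK: "- x \<in> K" if "x \<in> K" for x using imageI[OF that, of uminus] sym by simp
  have "0 \<in> K"
  proof -
    obtain x where x: "x \<in> K" using cv(2) interior_subset by blast
    have "(1/2) *\<^sub>R x + (1/2) *\<^sub>R (- x) \<in> K" by (rule convexD[OF cv(1) x symK[OF x]]) auto
    thus ?thesis by simp
  qed
  have c0: "c = 0"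
  proof (rule ccontr)
    assume ne: "c \<noteq> 0"
    have ac: "a \<bullet> c = 0" using c(1) by blast
    have r: "r \<ge> 0" using mem[of 0] \<open>0 \<in> K\<close> by (simp add: order_trans[OF norm_ge_zero])
    \<comment> \<open>The point of the ball farthest from the origin; its antipode is too far from
      \<open>c\<close>.\<close>
    define y where "y = (1 + r / norm c) *\<^sub>R c"
    have "c - y = (- (r / norm c)) *\<^sub>R c" by (simp add: y_def algebra_simps)
    hence "dist c y = r" using r ne by (simp add: dist_norm)
    hence "- y \<in> K" using mem[of y] ac by (intro symK) (simp add: y_def)
    hence "dist c (- y) \<le> r" using mem[of "- y"] ac by (simp add: y_def)
    moreover have "c + y = (2 + r / norm c) *\<^sub>R c" by (simp add: y_def algebra_simps scaleR_2)
    hence "dist c (- y) = 2 * norm c + r" using r ne by (simp add: dist_norm distrib_right)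
    ultimately show False using ne by simp
  qed
  have "x' \<in> K" if x: "x \<in> K" and x': "a \<bullet> x' = a \<bullet> x" "norm x' = norm x" for x x'
  proof -
    obtain u r' where u: "{y. a \<bullet> y = a \<bullet> x} \<inter> L = {u}"
      "K \<inter> {y. a \<bullet> y = a \<bullet> x} = cball u r' \<inter> {y. a \<bullet> y = a \<bullet> x}" using sec by blast
    \<comment> \<open>As \<open>L\<close> passes through the origin, the centre \<open>u\<close> is
      a multiple of \<open>a\<close>, so the distance to \<open>u\<close> depends only on the
      \<open>a\<close>-coordinate and the norm.\<close>
    obtain t0 where t0: "0 = p + t0 *\<^sub>R a" using Lp[of 0] c(1) c0 by blast
    obtain t1 where t1: "u = p + t1 *\<^sub>R a" using Lp[of u] u(1) by blast
    have "p = - (t0 *\<^sub>R a)" using t0 by (simp add: eq_neg_iff_add_eq_0)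
    hence ut: "u = (t1 - t0) *\<^sub>R a" using t1 by (simp add: algebra_simps)
    have "x \<bullet> x = x' \<bullet> x'" using x'(2) by (metis power2_norm_eq_inner)
    hence "dist u x' = dist u x"
      using x'(1) by (simp add: dist_norm ut norm_eq_sqrt_inner inner_simps inner_commute)
    moreover have "x \<in> cball u r' \<inter> {y. a \<bullet> y = a \<bullet> x}" using x by (simp only: u(2)[symmetric]) simp
    hence "dist u x \<le> r'" by simp
    ultimately have "x' \<in> cball u r' \<inter> {y. a \<bullet> y = a \<bullet> x}" using x'(1) by simp
    thus ?thesis using u(2) by blast
  qed
  thus ?thesis by blast
qed

section \<open>Recovering the body from a quadratic support function\<close>

text \<open>Induction by splitting off one vector: \<open>a\<close> is \<open>b\<close>-orthogonal
  to \<open>D'\<close>, and \<open>S\<close> sends it to a multiple of \<open>d\<close>. The range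
  condition in the induction keeps the values of \<open>S'\<close> orthogonal to
  \<open>d\<close>.\<close>

lemma pd_form_sqrt:
  fixes D :: "'a::euclidean_space set"
  assumes "subspace D" "pd_form D b"
  shows "\<exists>S. linear S \<and> range S \<subseteq> D \<and> (\<forall>x\<in>D. \<forall>y\<in>D. b x y = S x \<bullet> S y)"
  using assms
proof (induction "dim D" arbitrary: D rule: less_induct)
  case less
  note D = less.prems(1) and b = less.prems(2)
  note bl = pd_formD(1)[OF b] and sym = pd_formD(2)[OF b] and pos = pd_formD(3)[OF b]
  note bs = bilinear_ladd[OF bl] bilinear_radd[OF bl] bilinear_lmul[OF bl] bilinear_rmul[OF bl]
  show ?case
  proof (cases "D \<subseteq> {0}")
    case True
    thus ?thesis
      using subspace_0[OF D] bilinear_lzero[OF bl]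
      by (intro exI[of _ "\<lambda>_. 0"]) (auto simp: linear_zero)
  next
    case False
    then obtain d where d: "d \<in> D" "d \<noteq> 0" by blast
    define D' where "D' = D \<inter> {x. d \<bullet> x = 0}"
    have D': "subspace D'" unfolding D'_def by (intro subspace_inter D subspace_hyperplane)
    have sub: "D' \<subseteq> D" by (simp add: D'_def)
    have "d \<notin> D'" using d(2) by (simp add: D'_def)
    hence "\<not> dim D \<le> dim D'" using subspace_dim_equal[OF D' D sub] d(1) by blast
    hence dim: "dim D' < dim D" by simp
    have "pd_form D' b" using b by (simp add: pd_form_def D'_def)
    from less.hyps[OF dim D' this] obtain S' where S': "linear S'" "range S' \<subseteq> D'"
      "\<And>x y. x \<in> D' \<Longrightarrow> y \<in> D' \<Longrightarrow> b x y = S' x \<bullet> S' y" by blast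
    obtain a where a: "a \<in> D" "\<And>x. x \<in> D \<Longrightarrow> b a x = d \<bullet> x"
      using pd_form_representer[OF D b] by blast
    have "a \<noteq> 0" using a(2)[OF d(1)] d(2) bilinear_lzero[OF bl] by auto
    hence da: "d \<bullet> a > 0" using pos[OF a(1)] a by simp
    define \<tau> where "\<tau> x = (d \<bullet> x) / (d \<bullet> a)" for x
    \<comment> \<open>Makes the norm of \<open>n *\<^sub>R d\<close> equal to the
      \<open>b\<close>-length of \<open>a\<close>, since
      \<open>b a a = d \<bullet> a\<close>.\<close>
    define n where "n = sqrt (d \<bullet> a) / norm d"
    have n: "n * n * (d \<bullet> d) = d \<bullet> a"
      using da d(2) by (simp add: n_def power2_norm_eq_inner[symmetric] power2_eq_square)
    define S where "S x = S' (x - \<tau> x *\<^sub>R a) + (n * \<tau> x) *\<^sub>R d" for x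
    have \<tau>: "\<tau> (x + y) = \<tau> x + \<tau> y" "\<tau> (c *\<^sub>R x) = c * \<tau> x" for x y c
      by (simp_all add: \<tau>_def inner_simps add_divide_distrib)
    have "linear S"
    proof (rule linearI)
      fix x y
      have "x + y - \<tau> (x + y) *\<^sub>R a = (x - \<tau> x *\<^sub>R a) + (y - \<tau> y *\<^sub>R a)" by (simp add: \<tau> algebra_simps)
      from arg_cong[OF this, of S'] show "S (x + y) = S x + S y"
        by (simp add: S_def linear_add[OF S'(1)] \<tau>(1) distrib_left scaleR_add_left)
    next
      fix c x
      have "c *\<^sub>R x - \<tau> (c *\<^sub>R x) *\<^sub>R a = c *\<^sub>R (x - \<tau> x *\<^sub>R a)" by (simp add: \<tau> algebra_simps)
      from arg_cong[OF this, of S'] show "S (c *\<^sub>R x) = c *\<^sub>R S x"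
        by (simp add: S_def linear_scale[OF S'(1)] \<tau>(2) scaleR_add_right mult.left_commute)
    qed
    moreover have "range S \<subseteq> D"
      using S'(2) D d(1) by (auto simp: S_def D'_def intro!: subspace_add subspace_scale)
    moreover have "b x y = S x \<bullet> S y" if x: "x \<in> D" and y: "y \<in> D" for x y
    proof -
      define u where "u = x - \<tau> x *\<^sub>R a"
      define v where "v = y - \<tau> y *\<^sub>R a"
      have u: "u \<in> D'" unfolding u_def D'_def
        using x a(1) D da by (auto simp: \<tau>_def inner_simps intro: subspace_diff subspace_scale)
      have v: "v \<in> D'" unfolding v_def D'_def
        using y a(1) D da by (auto simp: \<tau>_def inner_simps intro: subspace_diff subspace_scale)
      have 0: "b a u = 0" "b u a = 0" "b a v = 0" using a(2) u v sym[of u a] by (simp_all add: D'_def)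
      have xu: "x = \<tau> x *\<^sub>R a + u" "y = \<tau> y *\<^sub>R a + v" by (simp_all add: u_def v_def)
      have "b x y = \<tau> x * \<tau> y * (d \<bullet> a) + S' u \<bullet> S' v"
        by (subst xu(1), subst xu(2)) (simp add: bs 0 a(2)[OF a(1)] S'(3)[OF u v])
      also have "\<dots> = S x \<bullet> S y"
      proof -
        have 1: "d \<bullet> S' w = 0" "S' w \<bullet> d = 0" for w
        proof -
          have "S' w \<in> D'" using S'(2) by blast
          thus "d \<bullet> S' w = 0" "S' w \<bullet> d = 0" by (simp_all add: D'_def inner_commute)
        qed
        have "S x \<bullet> S y = S' u \<bullet> S' v + \<tau> x * \<tau> y * (n * n * (d \<bullet> d))"
          by (simp add: S_def inner_simps 1 flip: u_def v_def)
        thus ?thesis by (simp add: n)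
      qed
      finally show ?thesis .
    qed
    ultimately show ?thesis by blast
  qed
qed

text \<open>The form is given by polarisation. Symmetry, additivity and homogeneity each involve at
  most three vectors, which share a hyperplane in dimension at least 4.\<close>

lemma quadratic_on_UNIV_if_hyperplanes:
  fixes F :: "'a::euclidean_space \<Rightarrow> real"
  assumes dim: "DIM('a) \<ge> 4" and quad: "\<And>w. w \<noteq> 0 \<Longrightarrow> quadratic_on F {y. w \<bullet> y = 0}"
  shows "quadratic_on F UNIV"
proof -
  define q where "q x y = ((F (x + y))\<^sup>2 - (F (x - y))\<^sup>2) / 4" for x y
  have local: "\<exists>b w. bilinear b \<and> w \<bullet> x = 0 \<and> w \<bullet> y = 0 \<and> w \<bullet> z = 0 \<and>
      (\<forall>s t. b s t = b t s) \<and> (\<forall>s. w \<bullet> s = 0 \<longrightarrow> (F s)\<^sup>2 = b s s) \<and>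
      (\<forall>s t. w \<bullet> s = 0 \<longrightarrow> w \<bullet> t = 0 \<longrightarrow> q s t = b s t)" for x y z
  proof -
    have "card {x, y, z} < DIM('a)" using dim by (simp add: card_insert_if)
    then obtain w where w: "w \<noteq> 0" "\<forall>s\<in>{x, y, z}. s \<bullet> w = 0"
      using ex_orthogonal_nonzero[of "{x, y, z}"] by blast
    obtain b where b: "bilinear b" "\<forall>s t. b s t = b t s" "\<forall>s. w \<bullet> s = 0 \<longrightarrow> (F s)\<^sup>2 = b s s"
      using quad[OF w(1)] unfolding quadratic_on_def by blast
    have "q s t = b s t" if "w \<bullet> s = 0" "w \<bullet> t = 0" for s t
    proof -
      have "b t s = b s t" using b(2) by blast
      thus ?thesis
        using that b(3) by (simp add: q_def inner_simps bilinear_ladd[OF b(1)] bilinear_radd[OF b(1)]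
            bilinear_lsub[OF b(1)] bilinear_rsub[OF b(1)])
    qed
    thus ?thesis using b w(2) by (intro exI[of _ b] exI[of _ w]) (simp add: inner_commute)
  qed
  have sym: "q x y = q y x" for x y
    using local[of x y y] by metis
  have add: "q x (y + z) = q x y + q x z" for x y z
  proof -
    obtain b w where b: "bilinear b" "w \<bullet> x = 0" "w \<bullet> y = 0" "w \<bullet> z = 0"
      "\<And>s t. w \<bullet> s = 0 \<Longrightarrow> w \<bullet> t = 0 \<Longrightarrow> q s t = b s t" using local[of x y z] by blast
    show ?thesis using b by (simp add: inner_simps bilinear_radd[OF b(1)])
  qed
  have scale: "q x (c *\<^sub>R y) = c * q x y" for x y c
  proof -
    obtain b w where b: "bilinear b" "w \<bullet> x = 0" "w \<bullet> y = 0"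
      "\<And>s t. w \<bullet> s = 0 \<Longrightarrow> w \<bullet> t = 0 \<Longrightarrow> q s t = b s t" using local[of x y y] by blast
    show ?thesis using b by (simp add: bilinear_rmul[OF b(1)])
  qed
  have "linear (q x)" for x by (rule linearI) (simp_all add: add scale)
  moreover have "(\<lambda>x. q x y) = q y" for y using sym by blast
  ultimately have "bilinear q" by (simp add: bilinear_def)
  moreover have "(F x)\<^sup>2 = q x x" for x
    using local[of x x x] by metis
  ultimately show ?thesis unfolding quadratic_on_def using sym by blast
qed

text \<open>Writing the support function as \<open>norm (S y)\<close> exhibits it as that of the
  image of the unit ball under the adjoint of \<open>S\<close>. Compact convex sets with equal
  support functions coincide by separation.\<close>

lemma ellipsoid_if_quadratic_support_function:
  fixes B :: "'a::euclidean_space set"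
  assumes B: "symmetric_convex_body B" and quad: "quadratic_on (support_function B) UNIV"
  shows "ellipsoid B"
proof -
  let ?F = "support_function B"
  note F = norm_like_support_function[OF B]
  have comp: "compact B" and conv: "convex B" and ne: "B \<noteq> {}"
    using B interior_subset by (auto simp: symmetric_convex_body_def convex_body_def)
  obtain q where q: "bilinear q" "\<And>x y. q x y = q y x" "\<And>x. (?F x)\<^sup>2 = q x x"
    using quad unfolding quadratic_on_def by blast
  have "pd_form UNIV q"
    unfolding pd_form_def
  proof (intro conjI ballI allI impI q(1,2))
    fix x :: 'a assume "x \<noteq> 0"
    thus "q x x > 0" using norm_like_pos[OF F] q(3) by (metis zero_less_power)
  qed
  from pd_form_sqrt[OF subspace_UNIV this] obtain S :: "'a \<Rightarrow> 'a" where S: "linear S"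
    and "\<forall>x\<in>UNIV. \<forall>y\<in>UNIV. q x y = S x \<bullet> S y" by (elim exE conjE)
  hence qS: "q x y = S x \<bullet> S y" for x y by simp
  have FS: "?F x = norm (S x)" for x
  proof -
    have "(?F x)\<^sup>2 = (norm (S x))\<^sup>2" by (simp add: q(3) qS power2_norm_eq_inner)
    thus ?thesis using norm_like_nonneg[OF F, of x] by (simp add: power2_eq_iff_nonneg)
  qed
  have "inj S"
    unfolding linear_injective_0[OF S]
  proof (intro allI impI)
    fix x assume "S x = 0"
    thus "x = 0" using FS[of x] norm_like_pos[OF F, of x] by fastforce
  qed
  hence surjS: "surj S" using linear_injective_imp_surjective[OF S] by simp
  define T where "T = adjoint S"
  have T: "T z \<bullet> y = z \<bullet> S y" for z y
    unfolding T_def using adjoint_works[OF S, of y z] by (simp add: inner_commute)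
  have linT: "linear T" unfolding T_def by (rule adjoint_linear[OF S])
  have "inj T"
    unfolding linear_injective_0[OF linT]
  proof (intro allI impI)
    fix z assume "T z = 0"
    hence 0: "z \<bullet> S y = 0" for y using T[of z y] by simp
    obtain y where "z = S y" using surjS by blast
    thus "z = 0" using 0[of y] by simp
  qed
  then obtain f where f: "linear f" "\<And>x. f (T x) = x" "\<And>x. T (f x) = x"
    using linear_injective_isomorphism[OF linT] by blast
  let ?E = "T ` cball 0 1"
  have E: "convex ?E" "closed ?E"
    using linT by (auto intro!: convex_linear_image compact_imp_closed compact_continuous_image
        linear_continuous_on simp: linear_conv_bounded_linear)
  have upE: "x \<bullet> y \<le> ?F y" if x: "x \<in> ?E" for x y
  proof -
    obtain z where z: "x = T z" "norm z \<le> 1" using x by auto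
    have "x \<bullet> y \<le> norm z * norm (S y)" unfolding z(1) T by (rule norm_cauchy_schwarz)
    also have "\<dots> \<le> 1 * norm (S y)" using z(2) by (intro mult_right_mono) auto
    finally show ?thesis by (simp add: FS)
  qed
  \<comment> \<open>The maximiser comes from the normalised vector \<open>S y\<close>;
    \<open>sgn 0 = 0\<close> covers the degenerate case.\<close>
  have exE: "\<exists>x\<in>?E. x \<bullet> y = ?F y" for y
  proof
    show "T (sgn (S y)) \<in> ?E" by (auto simp: norm_sgn)
    show "T (sgn (S y)) \<bullet> y = ?F y"
      by (cases "S y = 0") (simp_all add: T FS sgn_div_norm power2_norm_eq_inner[symmetric] power2_eq_square)
  qed
  have "B = ?E"
  proof (intro antisym subsetI)
    fix b assume b: "b \<in> B"
    show "b \<in> ?E"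
    proof (rule ccontr)
      assume "b \<notin> ?E"
      then obtain a \<beta> where a: "a \<bullet> b < \<beta>" "\<And>x. x \<in> ?E \<Longrightarrow> a \<bullet> x > \<beta>"
        using separating_hyperplane_closed_point[OF E] by blast
      obtain x where x: "x \<in> ?E" "x \<bullet> (- a) = ?F (- a)" using exE by blast
      have "b \<bullet> (- a) \<le> ?F (- a)" by (rule support_function_upper[OF comp b])
      thus False using a(1) a(2)[OF x(1)] x(2) by (simp add: inner_commute)
    qed
  next
    fix x assume x: "x \<in> ?E"
    show "x \<in> B"
    proof (rule ccontr)
      assume "x \<notin> B"
      then obtain a \<beta> where a: "a \<bullet> x < \<beta>" "\<And>b. b \<in> B \<Longrightarrow> a \<bullet> b > \<beta>"
        using separating_hyperplane_closed_point[OF conv compact_imp_closed[OF comp]] by blast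
      have "?F (- a) \<le> - \<beta>"
      proof (rule support_function_least[OF ne])
        fix b assume "b \<in> B"
        thus "b \<bullet> (- a) \<le> - \<beta>" using a(2) by (fastforce simp: inner_commute)
      qed
      thus False using upE[OF x, of "- a"] a(1) by (simp add: inner_commute)
    qed
  qed
  hence "f ` B = cball 0 1" using f by (simp add: image_image)
  moreover have "bij f" using f by (metis bijI')
  ultimately show ?thesis
    unfolding ellipsoid_def affinely_equivalent_def linear_isomorphism_def
    using f(1) by (intro conjI subspace_UNIV subset_UNIV exI[of _ f] bexI[of _ 0]) auto
qed

section \<open>Projections in terms of support functions\<close>

text \<open>On \<open>H\<close> the projection has the support function of \<open>B\<close>, and a
  linear image changes the argument by the adjoint. So \<open>g\<close> is the adjoint of
  \<open>f\<close> relative to \<open>H\<close>, and \<open>h\<close> inverts it on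
  \<open>H\<close>.\<close>

lemma linearly_equivalent_support_function:
  fixes B :: "'a::euclidean_space set" and K :: "'b::euclidean_space set"
  assumes "linearly_equivalent H (orthogonal_projection H ` B) UNIV K"
  shows "\<exists>h. linear h \<and> bij_betw h H UNIV \<and> (\<forall>y\<in>H. support_function B y = support_function K (h y))"
proof -
  define P where "P = orthogonal_projection H"
  have H: "subspace H" using assms by (simp add: linearly_equivalent_def)
  obtain f where f: "linear f" "bij_betw f H UNIV" "f ` P ` B = K"
    using assms by (auto simp: linearly_equivalent_def linear_isomorphism_def P_def)
  note P = orthogonal_projection_props[OF H, folded P_def]
  define g where "g \<xi> = P (adjoint f \<xi>)" for \<xi>
  have lin: "linear g"
    using linear_compose[OF adjoint_linear[OF f(1)] P(4)] by (simp add: g_def[abs_def] o_def)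
  have gH: "g \<xi> \<in> H" for \<xi> by (simp add: g_def P(1))
  have gf: "g \<xi> \<bullet> y = \<xi> \<bullet> f y" if "y \<in> H" for \<xi> y
  proof -
    have "g \<xi> \<bullet> y = adjoint f \<xi> \<bullet> y" by (simp add: g_def P(2)[OF that])
    also have "\<dots> = \<xi> \<bullet> f y" using adjoint_works[OF f(1), of y \<xi>] by (simp add: inner_commute)
    finally show ?thesis .
  qed
  have supp: "support_function K \<xi> = support_function B (g \<xi>)" for \<xi>
  proof -
    have "f (P b) \<bullet> \<xi> = b \<bullet> g \<xi>" for b
      using gf[OF P(1), of \<xi> b] P(2)[OF gH, of b \<xi>] by (simp add: inner_commute)
    thus ?thesis unfolding support_function_def f(3)[symmetric] image_image by simp
  qed
  have "inj g"
    unfolding linear_injective_0[OF lin]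
  proof (intro allI impI)
    fix \<xi> assume 0: "g \<xi> = 0"
    obtain y where y: "y \<in> H" "f y = \<xi>" using f(2) by (metis UNIV_I bij_betw_imp_surj_on imageE)
    show "\<xi> = 0" using gf[OF y(1), of \<xi>] y(2) 0 by simp
  qed
  then obtain h where h: "linear h" "h \<circ> g = id"
    using linear_injective_left_inverse[OF lin] by blast
  have hg: "h (g \<xi>) = \<xi>" for \<xi> using h(2) by (metis comp_apply id_apply)
  have "range g = H"
  proof (rule subspace_dim_equal)
    show "subspace (range g)" by (rule linear_subspace_image[OF lin subspace_UNIV])
    show "range g \<subseteq> H" using gH by blast
    have "dim H = dim (f ` H)"
      using dim_image_eq[OF f(1), of H] f(2) H by (metis bij_betw_imp_inj_on span_eq_iff)
    also have "\<dots> = dim (UNIV :: 'b set)" using f(2) by (simp add: bij_betw_def)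
    also have "\<dots> = dim (range g)" using dim_image_eq[OF lin, of UNIV] \<open>inj g\<close> by simp
    finally show "dim H \<le> dim (range g)" by simp
  qed (rule H)
  hence ex: "\<exists>\<xi>. y = g \<xi>" if "y \<in> H" for y using that by blast
  have "bij_betw h H UNIV"
    unfolding bij_betw_def inj_on_def using ex hg gH by (metis UNIV_eq_I imageI)
  moreover have "support_function B y = support_function K (h y)" if "y \<in> H" for y
    using ex[OF that] hg supp by metis
  ultimately show ?thesis using h(1) by blast
qed

theorem theorem1p2:
  fixes n :: nat
    and B :: "(real ^ 'm) set"
    and K :: "(real ^ 'n) set"
  assumes "n \<ge> 4"
    and "CARD('n) = n"
    and "CARD('m) = n + 1"
    and "symmetric_convex_body B"
    and "body_of_revolution K"
    and "\<And>H :: (real ^ 'm) set. hyperplane H \<Longrightarrow>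
           linearly_equivalent H (orthogonal_projection H ` B) UNIV K"
  shows "ellipsoid B"
proof -
  let ?F = "support_function B" and ?N = "support_function K"
  define H where "H x = {y. x \<bullet> y = 0}" for x :: "real ^ 'm"
  note F = norm_like_support_function[OF assms(4)]
  have sub: "subspace (H x)" for x unfolding H_def by (rule subspace_hyperplane)
  have dim: "DIM(real ^ 'm) \<ge> 5" using assms(1,3) by simp
  have hyp: "hyperplane (H x)" if "x \<noteq> 0" for x
    using dim_hyperplane[OF that] dim sub by (simp add: hyperplane_def H_def)
  have "\<exists>h. linear h \<and> bij_betw h (H x) UNIV \<and> (\<forall>y\<in>H x. ?F y = ?N (h y))" if "x \<noteq> 0" for x
    by (rule linearly_equivalent_support_function[OF assms(6)[OF hyp[OF that]]])
  then obtain h where h: "\<And>x. x \<noteq> 0 \<Longrightarrow> linear (h x)" "\<And>x. x \<noteq> 0 \<Longrightarrow> bij_betw (h x) (H x) UNIV"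
    "\<And>x y. x \<noteq> 0 \<Longrightarrow> y \<in> H x \<Longrightarrow> ?F y = ?N (h x y)" by metis
  obtain x0 :: "real ^ 'm" where x0: "x0 \<noteq> 0" using vector_choose_size[of 1] by force
  have K: "compact K" "K \<noteq> {}"
    using assms(5) interior_subset by (auto simp: body_of_revolution_def convex_body_def)
  \<comment> \<open>\<open>K\<close> is a linear image of \<open>B\<close> and inherits its central
    symmetry.\<close>
  have "uminus ` K = K"
  proof -
    define P where "P = orthogonal_projection (H x0)"
    obtain f where f: "linear f" "f ` P ` B = K"
      using assms(6)[OF hyp[OF x0]] by (auto simp: linearly_equivalent_def linear_isomorphism_def P_def)
    have "linear P" unfolding P_def by (rule linear_orthogonal_projection[OF sub])
    hence "uminus ` K = f ` P ` (uminus ` B)"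
      unfolding f(2)[symmetric] image_image by (simp add: linear_neg f(1))
    thus ?thesis using assms(4) f(2) by (simp add: symmetric_convex_body_def)
  qed
  from symmetric_body_of_revolution[OF assms(5) this] obtain a where
    a: "\<And>x x'. x \<in> K \<Longrightarrow> a \<bullet> x' = a \<bullet> x \<Longrightarrow> norm x' = norm x \<Longrightarrow> x' \<in> K" by blast
  have rot: "\<exists>e b. rotational ?F (H x) e b" if x: "x \<noteq> 0" for x
  proof -
    have lin: "linear (h x)" and inj: "inj_on (h x) (H x)"
      using h(1,2)[OF x] by (auto simp: bij_betw_def)
    \<comment> \<open>The rotational structure of \<open>K\<close> pulled back along
      \<open>h x\<close>: the adjoint carries the axis functional, and \<open>b\<close> is the
      pulled-back inner product.\<close>
    have "rotational ?F (H x) (adjoint (h x) a) (\<lambda>y z. h x y \<bullet> h x z)"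
      unfolding rotational_def pd_form_def
    proof (intro conjI ballI allI impI)
      show "bilinear (\<lambda>y z. h x y \<bullet> h x z)"
        by (simp add: bilinear_def linear_iff linear_add[OF lin] linear_scale[OF lin] inner_simps)
      show "h x y \<bullet> h x z = h x z \<bullet> h x y" for y z by (rule inner_commute)
      show "h x y \<bullet> h x y > 0" if "y \<in> H x" "y \<noteq> 0" for y
        using inj that linear_injective_on_subspace_0[OF lin sub] by auto
      fix y z assume yz: "y \<in> H x" "z \<in> H x"
        "adjoint (h x) a \<bullet> y = adjoint (h x) a \<bullet> z \<and> h x y \<bullet> h x y = h x z \<bullet> h x z"
      have "a \<bullet> h x y = a \<bullet> h x z" "norm (h x y) = norm (h x z)"
        using yz(3) adjoint_works[OF lin, of y a] adjoint_works[OF lin, of z a]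
        by (simp_all add: inner_commute norm_eq_sqrt_inner)
      from support_function_rotational[where a = a, OF K _ this] a have "?N (h x y) = ?N (h x z)"
        by blast
      thus "?F y = ?F z" using h(3)[OF x] yz(1,2) by simp
    qed
    thus ?thesis by blast
  qed
  have "\<exists>x. x \<noteq> 0 \<and> parallelogram ?F {y. x \<bullet> y = 0}"
    by (rule ex_parallelogram_hyperplane[OF F]) (use dim rot in \<open>auto simp: H_def\<close>)
  then obtain p where p: "p \<noteq> 0" "parallelogram ?F (H p)" unfolding H_def by blast
  \<comment> \<open>As \<open>h p\<close> is onto, the single Euclidean restriction makes the
    support function of \<open>K\<close> Euclidean; the maps \<open>h x\<close> then carry this to
    every hyperplane.\<close>
  have N: "parallelogram ?N UNIV"
    unfolding parallelogram_def
  proof (intro ballI)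
    fix u v
    obtain y z where yz: "y \<in> H p" "h p y = u" "z \<in> H p" "h p z = v"
      using h(2)[OF p(1)] by (metis UNIV_I bij_betw_imp_surj_on imageE)
    have "?N (u + v) = ?F (y + z)" "?N (u - v) = ?F (y - z)" "?N u = ?F y" "?N v = ?F z"
      using h(3)[OF p(1)] yz sub
      by (auto simp: linear_add[OF h(1)[OF p(1)]] linear_diff[OF h(1)[OF p(1)]] subspace_add subspace_diff)
    thus "(?N (u + v))\<^sup>2 + (?N (u - v))\<^sup>2 = 2 * (?N u)\<^sup>2 + 2 * (?N v)\<^sup>2"
      using p(2) yz unfolding parallelogram_def by simp
  qed
  have "quadratic_on ?F (H x)" if x: "x \<noteq> 0" for x
  proof -
    have par: "parallelogram ?F (H x)"
      unfolding parallelogram_def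
    proof (intro ballI)
      fix y z assume yz: "y \<in> H x" "z \<in> H x"
      hence "?F (y + z) = ?N (h x y + h x z)" "?F (y - z) = ?N (h x y - h x z)"
        using h(3)[OF x] sub
        by (simp_all add: linear_add[OF h(1)[OF x]] linear_diff[OF h(1)[OF x]] subspace_add subspace_diff)
      thus "(?F (y + z))\<^sup>2 + (?F (y - z))\<^sup>2 = 2 * (?F y)\<^sup>2 + 2 * (?F z)\<^sup>2"
        using N yz h(3)[OF x] unfolding parallelogram_def by simp
    qed
    \<comment> \<open>The rotational structure turns the parallelogram law into a quadratic form:
      \<open>rotational_quadratic_section\<close> is applied with \<open>H x\<close> itself as the
      section, and a vanishing axis vector is the equatorial case.\<close>
    obtain e b where eb: "rotational ?F (H x) e b" using rot[OF x] by blast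
    obtain c where c: "c \<in> H x" "\<And>y. y \<in> H x \<Longrightarrow> b c y = e \<bullet> y"
      using pd_form_representer[OF sub rotationalD(1)[OF eb]] by blast
    show ?thesis
    proof (cases "c = 0")
      case True
      hence "\<And>y. y \<in> H x \<Longrightarrow> e \<bullet> y = 0"
        using c(2) bilinear_lzero[OF pd_formD(1)[OF rotationalD(1)[OF eb]]] by metis
      thus ?thesis by (rule rotational_quadratic_equator[OF F sub eb])
    next
      case False
      have "card {x, e} < DIM(real ^ 'm)" using dim by (simp add: card_insert_if)
      then obtain u where "u \<noteq> 0" "\<forall>s\<in>{x, e}. s \<bullet> u = 0"
        using ex_orthogonal_nonzero[of "{x, e}"] by blast
      thus ?thesis
        by (intro rotational_quadratic_section[OF F sub eb c(1) False c(2) sub subset_refl c(1) _ _ _ par])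
          (auto simp: H_def)
    qed
  qed
  hence "quadratic_on ?F UNIV"
    using dim unfolding H_def by (intro quadratic_on_UNIV_if_hyperplanes) auto
  thus ?thesis by (rule ellipsoid_if_quadratic_support_function[OF assms(4)])
qed

end
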